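(* Let $p=p_n\to\infty$ as $n\to\infty$. Let $H^W_{1,n}$ be the set of all Watson distributions on $\mathbb{S}^{p-1}$ with concentration $\kappa<p/2$ (and arbitrary location), and define $$\delta_1(n)=\frac np\Big(\frac{\kappa}{p/2-\kappa}\Big)^2 .$$ Then there exists $\varepsilon>0$ sufficiently small such that $$\liminf_{n\to\infty}\ \inf_{\varphi\in\mathcal{T}_n}\Big\{\mathbb{P}_{\mu_0}(\varphi=1)+\sup_{\mu_n\in H^W_{1,n}:\ \delta_1(n)\ge\varepsilon}\mathbb{P}_{\mu_n}(\varphi=0)\Big\}\ \ge\ \frac14 ,$$ where in the supremum $\delta_1(n)$ is computed with the concentration $\kappa$ of $\mu_n$.
   Context: $\mathbb{S}^{p-1}=\{x\in\mathbb{R}^p:\|x\|_2=1\}$ and $\mu_0$ is the uniform distribution on it. The Watson distribution with concentration $\kappa>0$ and location $\theta\in\mathbb{S}^{p-1}$ has density proportional to $x\mapsto\exp(\kappa\,(x^\top\theta)^2)$ with respect to $\mu_0$. $\mathcal{T}_n$ is the set of all tests $\varphi=\varphi(X_1,\dots,X_n):(\mathbb{S}^{p-1})^n\to\{0,1\}$ (measurable functions of a sample of size $n$). $\mathbb{P}_\mu(\varphi=\cdot)$ is computed with $X_1,\dots,X_n$ i.i.d. from $\mu$. *)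

theory Defs
  imports "HOL-Probability.Probability"
begin

text \<open>
  The dimension varies with the sample size, so a vector of \<open>\<real>\<^sup>p\<close> is an extensional function on
  \<open>{..<p}\<close>, and \<open>\<real>\<^sup>p\<close> carries the product (= Borel) sigma-algebra.
\<close>

definition usphere :: "nat \<Rightarrow> (nat \<Rightarrow> real) set" where
  "usphere p = {x \<in> {..<p} \<rightarrow>\<^sub>E UNIV. L2_set x {..<p} = 1}"

definition uball :: "nat \<Rightarrow> (nat \<Rightarrow> real) set" where
  "uball p = {x \<in> {..<p} \<rightarrow>\<^sub>E UNIV. L2_set x {..<p} \<le> 1}"

definition sphere_borel :: "nat \<Rightarrow> (nat \<Rightarrow> real) measure" where
  "sphere_borel p = restrict_space (\<Pi>\<^sub>M i\<in>{..<p}. borel) (usphere p)"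

definition normalise :: "nat \<Rightarrow> (nat \<Rightarrow> real) \<Rightarrow> nat \<Rightarrow> real" where
  "normalise p x = (\<lambda>i\<in>{..<p}. x i / L2_set x {..<p})"

text \<open>
  Normalised surface measure, in its cone-measure form: the mass of \<open>A \<subseteq> S\<^sup>p\<^sup>-\<^sup>1\<close> is the fraction of the
  Lebesgue measure of the unit ball occupied by the cone \<open>{x. x / \<parallel>x\<parallel> \<in> A}\<close>.
  The point 0, sent to 0 by \<open>normalise\<close>, is a null set for \<open>p \<ge> 1\<close> and is cut off by the restriction.
\<close>

definition unif_sphere :: "nat \<Rightarrow> (nat \<Rightarrow> real) measure" where
  "unif_sphere p =
     restrict_space
       (distr (uniform_measure (\<Pi>\<^sub>M i\<in>{..<p}. lborel) (uball p)) (\<Pi>\<^sub>M i\<in>{..<p}. borel) (normalise p))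
       (usphere p)"

definition watson :: "nat \<Rightarrow> real \<Rightarrow> (nat \<Rightarrow> real) \<Rightarrow> (nat \<Rightarrow> real) measure" where
  "watson p \<kappa> \<theta> =
     density (unif_sphere p)
       (\<lambda>x. ennreal (exp (\<kappa> * (\<Sum>i<p. x i * \<theta> i)\<^sup>2)
              / (\<integral>y. exp (\<kappa> * (\<Sum>i<p. y i * \<theta> i)\<^sup>2) \<partial>unif_sphere p)))"

definition delta1 :: "nat \<Rightarrow> nat \<Rightarrow> real \<Rightarrow> real" where
  "delta1 n p \<kappa> = real n / real p * (\<kappa> / (real p / 2 - \<kappa>))\<^sup>2"

definition watson_alternatives :: "nat \<Rightarrow> nat \<Rightarrow> real \<Rightarrow> (nat \<Rightarrow> real) measure set" where
  "watson_alternatives n p \<epsilon> =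
     {watson p \<kappa> \<theta> | \<kappa> \<theta>. 0 < \<kappa> \<and> \<kappa> < real p / 2 \<and> \<theta> \<in> usphere p \<and> delta1 n p \<kappa> \<ge> \<epsilon>}"

text \<open>In a sample \<open>X\<close>, \<open>X j i\<close> is coordinate \<open>i < p\<close> of observation \<open>j < n\<close>.\<close>

definition tests :: "nat \<Rightarrow> nat \<Rightarrow> ((nat \<Rightarrow> nat \<Rightarrow> real) \<Rightarrow> nat) set" where
  "tests n p = (\<Pi>\<^sub>M j\<in>{..<n}. sphere_borel p) \<rightarrow>\<^sub>M count_space {0, 1}"

definition prob_test ::
    "nat \<Rightarrow> (nat \<Rightarrow> real) measure \<Rightarrow> ((nat \<Rightarrow> nat \<Rightarrow> real) \<Rightarrow> nat) \<Rightarrow> nat \<Rightarrow> real" where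
  "prob_test n \<mu> \<phi> b =
     measure (\<Pi>\<^sub>M j\<in>{..<n}. \<mu>) {X \<in> space (\<Pi>\<^sub>M j\<in>{..<n}. \<mu>). \<phi> X = b}"

end

theory Submission
  imports Defs "HOL-Probability.Hoeffding"
begin

text \<open>
  Truncated second-moment method. The location \<open>\<theta>\<close> is drawn uniformly from the \<open>2\<^sup>p\<close> normalised sign
  vectors, and \<open>\<kappa> = (p/2) t / (1 + t)\<close> with \<open>n t\<^sup>2 = \<epsilon> p\<close>, so that \<open>\<delta>\<^sub>1 = \<epsilon>\<close>. If \<open>L\<close> is the averaged
  likelihood ratio, restricted for each \<open>\<theta>\<close> to samples with \<open>\<Sum>\<^sub>j (X\<^sub>j \<bullet> \<theta>)\<^sup>2 \<le> 4 n (1 + t) / p\<close>, then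
  \<open>min 1 L \<ge> L - L\<^sup>2 / 4\<close> bounds the total error below by \<open>E L - E L\<^sup>2 / 4\<close>. A Chernoff bound gives
  \<open>E L \<ge> 3/4\<close>, and the contribution of a pair \<open>\<theta>, \<theta>'\<close> to \<open>E L\<^sup>2\<close> is at most
  \<open>exp (3 \<epsilon>) exp (49 \<epsilon> p (\<theta> \<bullet> \<theta>')\<^sup>2)\<close>, whose mean over the signs is at most \<open>2\<close> for \<open>\<epsilon> = 1/200\<close>.
  Without the truncation \<open>E L\<^sup>2\<close> can blow up when \<open>t\<close> is large.

  Spherical integrals are compared with Gaussian ones: for a standard Gaussian \<open>g\<close> in \<open>\<real>\<^sup>p\<close>,
  direction and length are independent and the direction is uniform. Gaussian integrals of
  \<open>exp (s (g \<bullet> v)\<^sup>2 / 2)\<close> are reduced to products by the Hubbard-Stratonovich identity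
  \<open>exp (s u\<^sup>2 / 2) = E exp (\<surd>s z u)\<close>, \<open>z\<close> standard normal.
\<close>

subsection \<open>Polar coordinates\<close>

text \<open>No rate links p and n, so t = sqrt (\<epsilon> p / n) may be tiny or arbitrarily large,
  and one argument must serve both regimes. In the Gaussian picture t is an excess variance: writing
  \<kappa> = s p / 2 with s = t / (1 + t), tilting by \<kappa> raises the variance of the projection
  on \<theta> from 1 to 1 / (1 - s) = 1 + t. Hence the truncation level, four times the typical size
  of the sum, and hence the obstacle: the Gaussian pair moment is finite only if t |\<theta>
  \<bullet> \<theta>'| < 1, which fails already at \<theta> = \<theta>' once t \<ge> 1. The
  constants fit together as 3/4 - 2/4 = 1/4. Sign vectors serve as prior because they form a finite
  set, so that the mixture is a finite sum, and because \<theta> \<bullet> \<theta>' is then a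
  normalised sum of independent signs, whose exponential moments are dominated by Gaussian ones. The
  choice of \<epsilon> respects 98 \<epsilon> < 1, which bounds the mean of exp (49 \<epsilon> p
  (\<theta> \<bullet> \<theta>')^2) uniformly in p.\<close>

definition dot :: "nat \<Rightarrow> (nat \<Rightarrow> real) \<Rightarrow> (nat \<Rightarrow> real) \<Rightarrow> real" where
  "dot p x y = (\<Sum>i<p. x i * y i)"

definition nrm :: "nat \<Rightarrow> (nat \<Rightarrow> real) \<Rightarrow> real" where
  "nrm p x = L2_set x {..<p}"

definition Rn :: "nat \<Rightarrow> (nat \<Rightarrow> real) measure" where
  "Rn p = (\<Pi>\<^sub>M i\<in>{..<p}. borel)"

definition leb :: "nat \<Rightarrow> (nat \<Rightarrow> real) measure" where
  "leb p = (\<Pi>\<^sub>M i\<in>{..<p}. lborel)"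

definition scale :: "nat \<Rightarrow> real \<Rightarrow> (nat \<Rightarrow> real) \<Rightarrow> nat \<Rightarrow> real" where
  "scale p c x = (\<lambda>i\<in>{..<p}. c * x i)"

text \<open>This is \<open>unif_sphere\<close> before its restriction to the sphere. It lives on all
  of \<open>Rn p\<close>, so the polar decomposition can be proved inside one measurable
  space.\<close>

definition sph :: "nat \<Rightarrow> (nat \<Rightarrow> real) measure" where
  "sph p = distr (uniform_measure (leb p) (uball p)) (Rn p) (normalise p)"

lemma sets_leb [simp, measurable_cong]: "sets (leb p) = sets (Rn p)"
  unfolding leb_def Rn_def by (rule sets_PiM_cong) auto

lemma space_Rn: "space (Rn p) = {..<p} \<rightarrow>\<^sub>E UNIV"
  by (simp add: Rn_def space_PiM)

lemma space_leb [simp]: "space (leb p) = space (Rn p)"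
  by (rule sets_eq_imp_space_eq) simp

lemma measurable_component_Rn [measurable]:
  "i < p \<Longrightarrow> (\<lambda>x. x i) \<in> borel_measurable (Rn p)"
  unfolding Rn_def by (rule measurable_component_singleton) auto

lemma measurable_dot [measurable]: "dot p y \<in> borel_measurable (Rn p)"
  unfolding dot_def[abs_def] by measurable

lemma measurable_nrm [measurable]: "nrm p \<in> borel_measurable (Rn p)"
  unfolding nrm_def L2_set_def by measurable

lemma measurable_normalise [measurable]: "normalise p \<in> Rn p \<rightarrow>\<^sub>M Rn p"
proof -
  have "(\<lambda>x. \<lambda>i\<in>{..<p}. x i / nrm p x) \<in> Rn p \<rightarrow>\<^sub>M (\<Pi>\<^sub>M i\<in>{..<p}. borel)"
    by (rule measurable_restrict) measurable
  then show ?thesis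
    by (simp add: Rn_def normalise_def[abs_def] nrm_def)
qed

lemma measurable_scale [measurable]: "scale p c \<in> Rn p \<rightarrow>\<^sub>M Rn p"
proof -
  have "(\<lambda>x. \<lambda>i\<in>{..<p}. c * x i) \<in> Rn p \<rightarrow>\<^sub>M (\<Pi>\<^sub>M i\<in>{..<p}. borel)"
    by (rule measurable_restrict) measurable
  then show ?thesis
    by (simp add: Rn_def scale_def[abs_def])
qed

lemma uball_eq: "uball p = {x \<in> space (Rn p). nrm p x \<le> 1}"
  by (auto simp: uball_def nrm_def space_Rn)

lemma usphere_eq: "usphere p = {x \<in> space (Rn p). nrm p x = 1}"
  by (auto simp: usphere_def nrm_def space_Rn)

lemma uball_sets [measurable]: "uball p \<in> sets (Rn p)"
  unfolding uball_eq by measurable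

lemma usphere_sets [measurable]: "usphere p \<in> sets (Rn p)"
  unfolding usphere_eq by measurable

lemma nrm_nonneg [simp]: "0 \<le> nrm p x"
  by (simp add: nrm_def)

lemma nrm_sq: "(nrm p x)\<^sup>2 = (\<Sum>i<p. (x i)\<^sup>2)"
  by (simp add: nrm_def L2_set_def sum_nonneg)

lemma nrm_scale: "0 \<le> c \<Longrightarrow> nrm p (scale p c x) = c * nrm p x"
proof -
  have "nrm p (scale p c x) = L2_set (\<lambda>i. c * x i) {..<p}"
    unfolding nrm_def by (rule L2_set_cong) (auto simp: scale_def)
  then show "0 \<le> c \<Longrightarrow> ?thesis"
    by (simp add: nrm_def L2_set_right_distrib)
qed

lemma scale_in_space [simp]: "scale p c x \<in> space (Rn p)"
  by (simp add: space_Rn scale_def)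

lemma normalise_in_space [simp]: "normalise p x \<in> space (Rn p)"
  by (simp add: space_Rn normalise_def)

lemma normalise_scale: "0 < c \<Longrightarrow> normalise p (scale p c x) = normalise p x"
  using nrm_scale[of c p x]
  by (auto simp: normalise_def nrm_def[symmetric] scale_def fun_eq_iff)

lemma normalise_usphere: "0 < nrm p x \<Longrightarrow> normalise p x \<in> usphere p"
proof -
  assume "0 < nrm p x"
  moreover have "normalise p x = scale p (inverse (nrm p x)) x"
    by (auto simp: normalise_def scale_def nrm_def divide_inverse fun_eq_iff)
  ultimately show ?thesis
    by (simp add: usphere_eq nrm_scale)
qed

section \<open>Dilations and the volume of cones\<close>

lemma product_sigma_finite_lborel: "product_sigma_finite (\<lambda>_::nat. lborel :: real measure)"
  by standard

text \<open>A product measure is determined by its values on boxes, and on a box each of the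
  \<open>p\<close> coordinates contributes one factor \<open>c\<close> by the affine change of
  variables on the line.\<close>

lemma leb_scaling:
  assumes c: "0 < c"
  shows "leb p = scale_measure (ennreal (c ^ p)) (distr (leb p) (Rn p) (scale p c))" (is "_ = ?P")
proof -
  interpret product_sigma_finite "\<lambda>_::nat. lborel :: real measure"
    by (rule product_sigma_finite_lborel)
  have "?P = (\<Pi>\<^sub>M i\<in>{..<p}. lborel)"
  proof (rule PiM_eqI)
    show "sets ?P = sets (\<Pi>\<^sub>M i\<in>{..<p}. lborel)"
      using sets_leb[of p] by (simp add: leb_def)
    fix A :: "nat \<Rightarrow> real set"
    assume "\<And>i. i \<in> {..<p} \<Longrightarrow> A i \<in> sets lborel"
    then have A: "A i \<in> sets borel" if "i < p" for i using that by auto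
    have m: "(\<lambda>x. c * x) -` A i \<in> sets borel" if "i < p" for i
      using measurable_sets_borel[OF _ A[OF that], of "\<lambda>x. c * x"] by simp
    have PA: "Pi\<^sub>E {..<p} A \<in> sets (Rn p)"
      unfolding Rn_def using A by (intro sets_PiM_I_finite) auto
    have "emeasure ?P (Pi\<^sub>E {..<p} A) = ennreal (c ^ p) * emeasure (leb p) (scale p c -` (Pi\<^sub>E {..<p} A) \<inter> space (Rn p))"
      using PA by (simp add: emeasure_distr)
    also have "scale p c -` (Pi\<^sub>E {..<p} A) \<inter> space (Rn p) = (\<Pi>\<^sub>E i\<in>{..<p}. (\<lambda>x. c * x) -` A i)"
      by (auto simp: scale_def space_Rn PiE_iff)
    also have "emeasure (leb p) \<dots> = (\<Prod>i<p. emeasure lborel ((\<lambda>x. c * x) -` A i))"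
      unfolding leb_def using m by (subst emeasure_PiM) auto
    also have "ennreal (c ^ p) * \<dots> = (\<Prod>i<p. ennreal c * emeasure lborel ((\<lambda>x. c * x) -` A i))"
      using c by (simp add: prod.distrib ennreal_power)
    also have "\<dots> = (\<Prod>i<p. emeasure lborel (A i))"
    proof (rule prod.cong)
      fix i assume "i \<in> {..<p}"
      then have i: "A i \<in> sets borel" using A by auto
      have "emeasure lborel (A i) = (\<integral>\<^sup>+x. indicator (A i) x \<partial>lborel)"
        using i by simp
      also have "\<dots> = ennreal c * (\<integral>\<^sup>+x. indicator (A i) (0 + c * x) \<partial>lborel)"
        using i c by (subst nn_integral_real_affine[where c = c and t = 0]) auto
      also have "(\<integral>\<^sup>+x. indicator (A i) (0 + c * x) \<partial>lborel) = (\<integral>\<^sup>+x. indicator ((\<lambda>x. c * x) -` A i) x \<partial>lborel)"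
        by (intro nn_integral_cong) (auto simp: indicator_def)
      finally show "ennreal c * emeasure lborel ((\<lambda>x. c * x) -` A i) = emeasure lborel (A i)"
        using m \<open>i \<in> {..<p}\<close> by simp
    qed simp
    finally show "emeasure ?P (Pi\<^sub>E {..<p} A) = (\<Prod>i\<in>{..<p}. emeasure lborel (A i))" .
  qed simp
  then show ?thesis by (simp add: leb_def)
qed

lemma nn_integral_leb_scale:
  assumes "0 < c" and f: "f \<in> borel_measurable (Rn p)"
  shows "(\<integral>\<^sup>+x. f x \<partial>leb p) = ennreal (c ^ p) * (\<integral>\<^sup>+x. f (scale p c x) \<partial>leb p)"
proof -
  have "(\<integral>\<^sup>+x. f x \<partial>leb p) = (\<integral>\<^sup>+x. f x \<partial>scale_measure (ennreal (c ^ p)) (distr (leb p) (Rn p) (scale p c)))"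
    using leb_scaling[OF assms(1), of p] by simp
  also have "\<dots> = ennreal (c ^ p) * (\<integral>\<^sup>+x. f (scale p c x) \<partial>leb p)"
    using f by (subst nn_integral_scale_measure) (auto simp: nn_integral_distr)
  finally show ?thesis .
qed

text \<open>A dilation preserves directions, so the part of a cone within radius \<open>r\<close> is
  the \<open>r\<close>-dilate of its part in the unit ball. This homogeneity is the source of the
  independence of length and direction.\<close>

lemma emeasure_cone_scale:
  assumes r: "0 < r" and A [measurable]: "A \<in> sets (Rn p)"
  shows "emeasure (leb p) {x \<in> space (Rn p). normalise p x \<in> A \<and> nrm p x \<le> r}
    = ennreal (r ^ p) * emeasure (leb p) {x \<in> space (Rn p). normalise p x \<in> A \<and> nrm p x \<le> 1}"
proof -
  have "emeasure (leb p) {x \<in> space (Rn p). normalise p x \<in> A \<and> nrm p x \<le> r}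
     = (\<integral>\<^sup>+x. indicator {x \<in> space (Rn p). normalise p x \<in> A \<and> nrm p x \<le> r} x \<partial>leb p)"
    by (rule nn_integral_indicator[symmetric]) measurable
  also have "\<dots> = ennreal (r ^ p) *
     (\<integral>\<^sup>+x. indicator {x \<in> space (Rn p). normalise p x \<in> A \<and> nrm p x \<le> r} (scale p r x) \<partial>leb p)"
    by (rule nn_integral_leb_scale[OF r]) measurable
  also have "(\<integral>\<^sup>+x. indicator {x \<in> space (Rn p). normalise p x \<in> A \<and> nrm p x \<le> r} (scale p r x) \<partial>leb p)
    = (\<integral>\<^sup>+x. indicator {x \<in> space (Rn p). normalise p x \<in> A \<and> nrm p x \<le> 1} x \<partial>leb p)"
    using r by (intro nn_integral_cong) (auto simp: indicator_def normalise_scale nrm_scale)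
  also have "\<dots> = emeasure (leb p) {x \<in> space (Rn p). normalise p x \<in> A \<and> nrm p x \<le> 1}"
    by (rule nn_integral_indicator) measurable
  finally show ?thesis .
qed

lemma emeasure_leb_box:
  "(\<And>i. i < p \<Longrightarrow> A i \<in> sets borel) \<Longrightarrow> emeasure (leb p) (Pi\<^sub>E {..<p} A) = (\<Prod>i<p. emeasure lborel (A i))"
proof -
  interpret product_sigma_finite "\<lambda>_::nat. lborel :: real measure"
    by (rule product_sigma_finite_lborel)
  assume "\<And>i. i < p \<Longrightarrow> A i \<in> sets borel"
  then show ?thesis unfolding leb_def by (subst emeasure_PiM) auto
qed

lemma component_le_nrm: "i < p \<Longrightarrow> \<bar>x i\<bar> \<le> nrm p x"
  unfolding nrm_def using member_le_L2_set[of "{..<p}" i "\<lambda>i. \<bar>x i\<bar>"]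
  by (simp add: L2_set_def)

lemma emeasure_uball_finite: "emeasure (leb p) (uball p) < \<infinity>"
proof -
  have "uball p \<subseteq> (\<Pi>\<^sub>E i\<in>{..<p}. {-1..1})"
  proof
    fix x assume x: "x \<in> uball p"
    have "x i \<in> {-1..1}" if "i < p" for i
      using component_le_nrm[OF that, of x] x by (auto simp: uball_eq)
    then show "x \<in> (\<Pi>\<^sub>E i\<in>{..<p}. {-1..1})"
      using x by (auto simp: uball_eq space_Rn PiE_iff)
  qed
  then have "emeasure (leb p) (uball p) \<le> emeasure (leb p) (\<Pi>\<^sub>E i\<in>{..<p}. {-1..1})"
    by (rule emeasure_mono) (auto simp: Rn_def intro!: sets_PiM_I_finite)
  also have "\<dots> = (\<Prod>i<p. emeasure lborel {-1..1::real})"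
    by (rule emeasure_leb_box) simp
  also have "\<dots> < \<infinity>"
    by (simp add: power_less_top_ennreal)
  finally show ?thesis .
qed

text \<open>Together with finiteness this makes the division inside \<open>uniform_measure\<close>
  meaningful. A box of half-side \<open>1 / p\<close> fits into the ball because the Euclidean norm
  is at most the sum of the absolute values; for \<open>p = 0\<close> the space is a single point of
  mass 1.\<close>

lemma emeasure_uball_pos: "0 < emeasure (leb p) (uball p)"
proof (cases "p = 0")
  case True
  then have "emeasure (leb p) (\<Pi>\<^sub>E i\<in>{..<p}. {}) = 1"
    by (subst emeasure_leb_box) auto
  moreover have "(\<Pi>\<^sub>E i\<in>{..<p}. {}) \<subseteq> uball p"
    using True by (auto simp: uball_def)
  then have "emeasure (leb p) (\<Pi>\<^sub>E i\<in>{..<p}. {}) \<le> emeasure (leb p) (uball p)"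
    by (rule emeasure_mono) simp
  ultimately show ?thesis by (metis less_le_trans zero_less_one)
next
  case False
  let ?a = "1 / real p"
  have sub: "(\<Pi>\<^sub>E i\<in>{..<p}. {-?a..?a}) \<subseteq> uball p"
  proof
    fix x assume x: "x \<in> (\<Pi>\<^sub>E i\<in>{..<p}. {-?a..?a})"
    have "nrm p x \<le> (\<Sum>i<p. \<bar>x i\<bar>)"
      unfolding nrm_def by (rule L2_set_le_sum_abs)
    also have "\<dots> \<le> (\<Sum>i<p. ?a)"
    proof (rule sum_mono)
      fix i assume "i \<in> {..<p}"
      then have "x i \<in> {-?a..?a}" using x by (auto simp: PiE_iff)
      then show "\<bar>x i\<bar> \<le> ?a" by (auto simp: abs_le_iff)
    qed
    also have "\<dots> = 1" using False by simp
    finally show "x \<in> uball p" using x by (auto simp: uball_eq space_Rn PiE_iff)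
  qed
  have "0 < ennreal ((2 * ?a) ^ p)" using False by simp
  also have "ennreal ((2 * ?a) ^ p) = (\<Prod>i<p. emeasure lborel {-?a..?a})"
    by (simp add: ennreal_power)
  also have "\<dots> = emeasure (leb p) (\<Pi>\<^sub>E i\<in>{..<p}. {-?a..?a})"
    by (rule emeasure_leb_box[symmetric]) simp
  also have "\<dots> \<le> emeasure (leb p) (uball p)"
    by (rule emeasure_mono[OF sub]) simp
  finally show ?thesis .
qed

lemma emeasure_nrm_nonpos:
  assumes "0 < p" "r \<le> 0"
  shows "emeasure (leb p) {x \<in> space (Rn p). nrm p x \<le> r} = 0"
proof -
  have "{x \<in> space (Rn p). nrm p x \<le> r} \<subseteq> (\<Pi>\<^sub>E i\<in>{..<p}. {0})"
  proof
    fix x assume x: "x \<in> {x \<in> space (Rn p). nrm p x \<le> r}"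
    then have "nrm p x = 0" using assms(2) by (intro antisym) (auto intro: order_trans)
    then have "x i = 0" if "i < p" for i using component_le_nrm[OF that, of x] by simp
    then show "x \<in> (\<Pi>\<^sub>E i\<in>{..<p}. {0})"
      using x by (auto simp: space_Rn PiE_def extensional_def fun_eq_iff)
  qed
  then have "emeasure (leb p) {x \<in> space (Rn p). nrm p x \<le> r} \<le> emeasure (leb p) (\<Pi>\<^sub>E i\<in>{..<p}. {0})"
    by (rule emeasure_mono) (unfold sets_leb Rn_def, rule sets_PiM_I_finite, auto)
  also have "\<dots> = 0" using assms(1) emeasure_leb_box[of p "\<lambda>_. {0}"] by simp
  finally show ?thesis by simp
qed

section \<open>Independence of length and direction under Lebesgue measure\<close>

lemma sets_sph [simp, measurable_cong]: "sets (sph p) = sets (Rn p)"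
  by (simp add: sph_def)

lemma space_sph [simp]: "space (sph p) = space (Rn p)"
  by (simp add: sph_def)

lemma emeasure_sph:
  assumes [measurable]: "A \<in> sets (Rn p)"
  shows "emeasure (sph p) A =
    emeasure (leb p) {x \<in> space (Rn p). normalise p x \<in> A \<and> nrm p x \<le> 1} / emeasure (leb p) (uball p)"
proof -
  have "emeasure (sph p) A = emeasure (uniform_measure (leb p) (uball p)) (normalise p -` A \<inter> space (Rn p))"
    unfolding sph_def by (subst emeasure_distr) auto
  also have "\<dots> = emeasure (leb p) (uball p \<inter> (normalise p -` A \<inter> space (Rn p))) / emeasure (leb p) (uball p)"
    by (rule emeasure_uniform_measure) auto
  also have "uball p \<inter> (normalise p -` A \<inter> space (Rn p)) = {x \<in> space (Rn p). normalise p x \<in> A \<and> nrm p x \<le> 1}"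
    by (auto simp: uball_eq)
  finally show ?thesis .
qed

text \<open>Restricting to a cone multiplies the law of the length by the share of the cone,
  whatever the radius. By homogeneity both sides agree on the half-lines \<open>{..r}\<close>, which
  generate the Borel sets and have finite mass; for \<open>r \<le> 0\<close> both sides vanish,
  since the origin is a null set.\<close>

lemma distr_nrm_cone:
  assumes p: "0 < p" and A [measurable]: "A \<in> sets (Rn p)"
  shows "distr (density (leb p) (indicator {x \<in> space (Rn p). normalise p x \<in> A})) borel (nrm p)
    = scale_measure (emeasure (sph p) A) (distr (leb p) borel (nrm p))" (is "?L = ?R")
proof -
  have C [measurable]: "{x \<in> space (Rn p). normalise p x \<in> A} \<in> sets (Rn p)" by measurable
  have L: "emeasure ?L {..r} = emeasure (leb p) {x \<in> space (Rn p). normalise p x \<in> A \<and> nrm p x \<le> r}" for r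
  proof -
    have m: "{x \<in> space (Rn p). nrm p x \<le> r} \<in> sets (Rn p)" by measurable
    have "emeasure ?L {..r} = emeasure (density (leb p) (indicator {x \<in> space (Rn p). normalise p x \<in> A}))
        (nrm p -` {..r} \<inter> space (Rn p))"
      by (subst emeasure_distr) auto
    also have "nrm p -` {..r} \<inter> space (Rn p) = {x \<in> space (Rn p). nrm p x \<le> r}" by auto
    also have "emeasure (density (leb p) (indicator {x \<in> space (Rn p). normalise p x \<in> A})) \<dots>
      = (\<integral>\<^sup>+x. indicator {x \<in> space (Rn p). normalise p x \<in> A} x * indicator {x \<in> space (Rn p). nrm p x \<le> r} x \<partial>leb p)"
      using m by (subst emeasure_density) auto
    also have "\<dots> = (\<integral>\<^sup>+x. indicator {x \<in> space (Rn p). normalise p x \<in> A \<and> nrm p x \<le> r} x \<partial>leb p)"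
      by (intro nn_integral_cong) (auto simp: indicator_def)
    also have "\<dots> = emeasure (leb p) {x \<in> space (Rn p). normalise p x \<in> A \<and> nrm p x \<le> r}"
      by (rule nn_integral_indicator) measurable
    finally show ?thesis .
  qed
  have R: "emeasure ?R {..r} = emeasure (sph p) A * emeasure (leb p) {x \<in> space (Rn p). nrm p x \<le> r}" for r
  proof -
    have "nrm p -` {..r} \<inter> space (Rn p) = {x \<in> space (Rn p). nrm p x \<le> r}" by auto
    then show ?thesis by (simp add: emeasure_distr)
  qed
  have ballr: "emeasure (leb p) {x \<in> space (Rn p). nrm p x \<le> r} = ennreal (r ^ p) * emeasure (leb p) (uball p)"
    if "0 < r" for r
    using emeasure_cone_scale[OF that, of "space (Rn p)" p] by (simp add: uball_eq)
  have eq: "emeasure ?L {..r} = emeasure ?R {..r}" for r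
  proof (cases "0 < r")
    case True
    have "emeasure (sph p) A * (ennreal (r ^ p) * emeasure (leb p) (uball p))
       = ennreal (r ^ p) * (emeasure (sph p) A * emeasure (leb p) (uball p))"
      by (simp add: ac_simps)
    also have "emeasure (sph p) A * emeasure (leb p) (uball p)
        = emeasure (leb p) {x \<in> space (Rn p). normalise p x \<in> A \<and> nrm p x \<le> 1}"
      using emeasure_uball_pos[of p] emeasure_uball_finite[of p]
      by (simp add: emeasure_sph ennreal_divide_times)
    finally show ?thesis
      unfolding L R ballr[OF True] by (simp add: emeasure_cone_scale[OF True A])
  next
    case False
    have "emeasure (leb p) {x \<in> space (Rn p). normalise p x \<in> A \<and> nrm p x \<le> r}
        \<le> emeasure (leb p) {x \<in> space (Rn p). nrm p x \<le> r}"
      by (rule emeasure_mono) auto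
    then show ?thesis
      unfolding L R using emeasure_nrm_nonpos[OF p, of r] False by simp
  qed
  show ?thesis
  proof (rule measure_eqI_generator_eq[where E = "range atMost" and \<Omega> = UNIV and A = "\<lambda>i. {..real i}"])
    show "Int_stable (range atMost :: real set set)"
      by (auto simp: Int_stable_def)
    show "sets ?L = sigma_sets UNIV (range atMost)"
      by (simp, subst borel_eq_atMost, simp)
    show "sets ?R = sigma_sets UNIV (range atMost)"
      by (simp, subst borel_eq_atMost, simp)
    show "(\<Union>i. {..real i}) = UNIV"
      using real_arch_simple by auto
    fix i :: nat
    have "emeasure ?L {..real i} \<le> emeasure ?L {..real (Suc i)}"
      by (rule emeasure_mono) auto
    also have "\<dots> \<le> emeasure (leb p) {x \<in> space (Rn p). nrm p x \<le> real (Suc i)}"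
      unfolding L by (rule emeasure_mono) auto
    also have "\<dots> < \<infinity>"
      using ballr[of "real (Suc i)"] emeasure_uball_finite[of p] by (simp add: ennreal_mult_less_top)
    finally show "emeasure ?L {..real i} \<noteq> \<infinity>" by simp
  qed (auto simp: eq)
qed

text \<open>For a fixed set \<open>A\<close> of directions the radial weight is integrated against
  the law of the length on the cone over \<open>A\<close>, where \<open>distr_nrm_cone\<close>
  splits off the mass of \<open>A\<close>. Letting \<open>A\<close> vary identifies the law of the
  direction under the weighted measure, and the integral formula follows.\<close>

lemma polar_sph:
  assumes p: "0 < p" and [measurable]: "f \<in> borel_measurable (Rn p)" "w \<in> borel_measurable borel"
  shows "(\<integral>\<^sup>+x. f (normalise p x) * w (nrm p x) \<partial>leb p) = (\<integral>\<^sup>+y. f y \<partial>sph p) * (\<integral>\<^sup>+x. w (nrm p x) \<partial>leb p)"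
proof -
  let ?W = "\<integral>\<^sup>+x. w (nrm p x) \<partial>leb p"
  have "distr (density (leb p) (\<lambda>x. w (nrm p x))) (Rn p) (normalise p) = scale_measure ?W (sph p)"
  proof (rule measure_eqI)
    fix A assume "A \<in> sets (distr (density (leb p) (\<lambda>x. w (nrm p x))) (Rn p) (normalise p))"
    then have A [measurable]: "A \<in> sets (Rn p)" by simp
    let ?C = "{x \<in> space (Rn p). normalise p x \<in> A}"
    have C [measurable]: "?C \<in> sets (Rn p)" by measurable
    have "emeasure (distr (density (leb p) (\<lambda>x. w (nrm p x))) (Rn p) (normalise p)) A
       = emeasure (density (leb p) (\<lambda>x. w (nrm p x))) (normalise p -` A \<inter> space (Rn p))"
      by (subst emeasure_distr) auto
    also have "normalise p -` A \<inter> space (Rn p) = ?C" by auto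
    also have "emeasure (density (leb p) (\<lambda>x. w (nrm p x))) ?C = (\<integral>\<^sup>+x. w (nrm p x) * indicator ?C x \<partial>leb p)"
      by (rule emeasure_density) auto
    also have "\<dots> = (\<integral>\<^sup>+x. w (nrm p x) \<partial>density (leb p) (indicator ?C))"
      by (subst nn_integral_density) (auto simp: mult.commute)
    also have "\<dots> = (\<integral>\<^sup>+r. w r \<partial>distr (density (leb p) (indicator ?C)) borel (nrm p))"
      by (subst nn_integral_distr) auto
    also have "\<dots> = emeasure (sph p) A * ?W"
      unfolding distr_nrm_cone[OF p A] by (subst nn_integral_scale_measure) (auto simp: nn_integral_distr)
    finally show "emeasure (distr (density (leb p) (\<lambda>x. w (nrm p x))) (Rn p) (normalise p)) A
      = emeasure (scale_measure ?W (sph p)) A"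
      by (simp add: mult.commute)
  qed simp
  then have "(\<integral>\<^sup>+y. f y \<partial>distr (density (leb p) (\<lambda>x. w (nrm p x))) (Rn p) (normalise p))
      = (\<integral>\<^sup>+y. f y \<partial>scale_measure ?W (sph p))" by simp
  then show ?thesis
    by (simp add: nn_integral_scale_measure nn_integral_distr nn_integral_density mult.commute)
qed

lemma unif_sphere_eq: "unif_sphere p = restrict_space (sph p) (usphere p)"
  by (simp add: unif_sphere_def sph_def leb_def Rn_def)

lemma sets_unif_sphere [simp, measurable_cong]: "sets (unif_sphere p) = sets (sphere_borel p)"
  unfolding unif_sphere_eq sphere_borel_def Rn_def[symmetric] by (simp add: sets_restrict_space)

lemma space_unif_sphere [simp]: "space (unif_sphere p) = usphere p"
  unfolding unif_sphere_eq using sets.sets_into_space[OF usphere_sets[of p]]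
  by (simp add: space_restrict_space Int_absorb2)

lemma measurable_sphere_Rn: "f \<in> borel_measurable (Rn p) \<Longrightarrow> f \<in> borel_measurable (sphere_borel p)"
  unfolding sphere_borel_def Rn_def[symmetric] by (rule measurable_restrict_space1)

lemma AE_leb_nrm_pos: "0 < p \<Longrightarrow> AE x in leb p. 0 < nrm p x"
proof (rule AE_I)
  assume "0 < p"
  show "{x \<in> space (leb p). \<not> 0 < nrm p x} \<subseteq> {x \<in> space (Rn p). nrm p x \<le> 0}" by auto
  show "emeasure (leb p) {x \<in> space (Rn p). nrm p x \<le> 0} = 0"
    using \<open>0 < p\<close> by (rule emeasure_nrm_nonpos) simp
  show "{x \<in> space (Rn p). nrm p x \<le> 0} \<in> sets (leb p)" by measurable
qed

lemma polar_unif_sphere: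
  assumes p: "0 < p" and [measurable]: "f \<in> borel_measurable (Rn p)" "w \<in> borel_measurable borel"
  shows "(\<integral>\<^sup>+x. f (normalise p x) * w (nrm p x) \<partial>leb p)
    = (\<integral>\<^sup>+y. f y \<partial>unif_sphere p) * (\<integral>\<^sup>+x. w (nrm p x) \<partial>leb p)"
proof -
  \<comment> \<open>Off the origin, a null set, \<open>normalise p x\<close> lies on the sphere, so
    the indicator that turns \<open>sph\<close> into \<open>unif_sphere\<close> can be inserted
    freely.\<close>
  have "(\<integral>\<^sup>+x. f (normalise p x) * w (nrm p x) \<partial>leb p)
      = (\<integral>\<^sup>+x. (f (normalise p x) * indicator (usphere p) (normalise p x)) * w (nrm p x) \<partial>leb p)"
    using AE_leb_nrm_pos[OF p]
    by (intro nn_integral_cong_AE) (auto simp: normalise_usphere elim!: eventually_mono)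
  also have "\<dots> = (\<integral>\<^sup>+y. f y * indicator (usphere p) y \<partial>sph p) * (\<integral>\<^sup>+x. w (nrm p x) \<partial>leb p)"
    by (rule polar_sph[OF p, where f = "\<lambda>y. f y * indicator (usphere p) y"]) auto
  also have "(\<integral>\<^sup>+y. f y * indicator (usphere p) y \<partial>sph p) = (\<integral>\<^sup>+y. f y \<partial>unif_sphere p)"
    unfolding unif_sphere_eq by (subst nn_integral_restrict_space) auto
  finally show ?thesis .
qed

subsection \<open>Gaussian integrals\<close>

definition std_normal :: "real measure" where
  "std_normal = density lborel (\<lambda>x. ennreal (std_normal_density x))"

text \<open>Defined by a density with respect to \<open>leb\<close> because the polar formula is
  stated for \<open>leb\<close>. This density is a function of the norm alone and so can be absorbed
  into the radial weight.\<close>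

definition gauss :: "nat \<Rightarrow> (nat \<Rightarrow> real) measure" where
  "gauss p = density (leb p) (\<lambda>x. \<Prod>i<p. ennreal (std_normal_density (x i)))"

lemma sets_std_normal [simp, measurable_cong]: "sets std_normal = sets borel"
  by (simp add: std_normal_def)

lemma measurable_std_normal [simp]: "measurable std_normal M = measurable borel M"
  by (rule measurable_cong_sets) auto

lemma space_std_normal [simp]: "space std_normal = UNIV"
  by (simp add: std_normal_def)

lemma sets_gauss [simp, measurable_cong]: "sets (gauss p) = sets (Rn p)"
  by (simp add: gauss_def)

lemma space_gauss [simp]: "space (gauss p) = space (Rn p)"
  by (simp add: gauss_def)

lemma nn_integral_gauss_prod:
  assumes f: "\<And>i. i < p \<Longrightarrow> f i \<in> borel_measurable borel"
  shows "(\<integral>\<^sup>+x. (\<Prod>i<p. f i (x i)) \<partial>gauss p) = (\<Prod>i<p. \<integral>\<^sup>+x. f i x \<partial>std_normal)"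
proof -
  interpret product_sigma_finite "\<lambda>_::nat. lborel :: real measure"
    by (rule product_sigma_finite_lborel)
  have m: "(\<lambda>x. f i (x i)) \<in> borel_measurable (Rn p)" if "i < p" for i
    by (rule measurable_compose[OF measurable_component_Rn[OF that] f[OF that]])
  have [measurable]: "(\<lambda>x. \<Prod>i<p. f i (x i)) \<in> borel_measurable (Rn p)"
    using m by (intro borel_measurable_prod_ennreal) auto
  have "(\<integral>\<^sup>+x. (\<Prod>i<p. f i (x i)) \<partial>gauss p)
      = (\<integral>\<^sup>+x. (\<Prod>i<p. ennreal (std_normal_density (x i)) * f i (x i)) \<partial>leb p)"
    unfolding gauss_def by (subst nn_integral_density) (auto simp: prod.distrib)
  also have "\<dots> = (\<Prod>i<p. \<integral>\<^sup>+x. ennreal (std_normal_density x) * f i x \<partial>lborel)"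
    unfolding leb_def using f by (subst product_nn_integral_prod) auto
  also have "\<dots> = (\<Prod>i<p. \<integral>\<^sup>+x. f i x \<partial>std_normal)"
    unfolding std_normal_def using f by (intro prod.cong refl) (subst nn_integral_density, auto)
  finally show ?thesis .
qed

text \<open>Completing the square: up to a constant, the tilted density is that of the normal law
  with mean \<open>b / (1 - a)\<close> and variance \<open>1 / (1 - a)\<close>.\<close>

lemma nn_integral_std_normal_exp:
  assumes a: "a < 1"
  shows "(\<integral>\<^sup>+z. ennreal (exp (a * z\<^sup>2 / 2 + b * z)) \<partial>std_normal)
    = ennreal (exp (b\<^sup>2 / (2 * (1 - a))) / sqrt (1 - a))"
proof -
  define \<sigma> where "\<sigma> = 1 / sqrt (1 - a)"
  have \<sigma>: "0 < \<sigma>" "\<sigma>\<^sup>2 = 1 / (1 - a)" using a by (simp_all add: \<sigma>_def power_divide)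
  define \<mu> where "\<mu> = b / (1 - a)"
  define C where "C = exp (b\<^sup>2 / (2 * (1 - a))) / sqrt (1 - a)"
  have eq: "std_normal_density z * exp (a * z\<^sup>2 / 2 + b * z) = C * normal_density \<mu> \<sigma> z" for z
  proof -
    have e: "- z\<^sup>2 / 2 + (a * z\<^sup>2 / 2 + b * z) = b\<^sup>2 / (2 * (1 - a)) + - (z - \<mu>)\<^sup>2 / (2 * \<sigma>\<^sup>2)"
    proof -
      obtain d where d: "a = 1 - d" "d \<noteq> 0" using a that[of "1 - a"] by auto
      show ?thesis unfolding \<sigma>(2) \<mu>_def d(1) using d(2) by (simp add: field_simps power2_eq_square)
    qed
    have "exp (- z\<^sup>2 / 2) * exp (a * z\<^sup>2 / 2 + b * z) = exp (b\<^sup>2 / (2 * (1 - a))) * exp (- (z - \<mu>)\<^sup>2 / (2 * \<sigma>\<^sup>2))"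
      unfolding exp_add[symmetric] e ..
    moreover have "sqrt (2 * pi * \<sigma>\<^sup>2) = sqrt (2 * pi) / sqrt (1 - a)"
      by (simp add: \<sigma>(2) real_sqrt_divide)
    ultimately show ?thesis
      using a by (simp add: normal_density_def C_def field_simps)
  qed
  have "(\<integral>\<^sup>+z. ennreal (exp (a * z\<^sup>2 / 2 + b * z)) \<partial>std_normal)
     = (\<integral>\<^sup>+z. ennreal C * ennreal (normal_density \<mu> \<sigma> z) \<partial>lborel)"
    unfolding std_normal_def using eq a
    by (subst nn_integral_density) (auto simp: ennreal_mult[symmetric] C_def)
  also have "\<dots> = ennreal C * (\<integral>\<^sup>+z. ennreal (normal_density \<mu> \<sigma> z) \<partial>lborel)"
    by (rule nn_integral_cmult) auto
  also have "(\<integral>\<^sup>+z. ennreal (normal_density \<mu> \<sigma> z) \<partial>lborel) = ennreal (\<integral>z. normal_density \<mu> \<sigma> z \<partial>lborel)"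
    using \<sigma>(1) by (intro nn_integral_eq_integral) auto
  also have "\<dots> = 1" using \<sigma>(1) by simp
  finally show ?thesis by (simp add: C_def)
qed

text \<open>A quadratic tilt changes only the variance, to \<open>1 / (1 - a)\<close>, so the
  integral is a multiple of an even moment of a centred normal law. The quotient of factorials is
  the double factorial (2k - 1)!!; the values \<open>k = 0, 1, 2\<close> occur below.\<close>

lemma nn_integral_std_normal_moment_exp:
  assumes a: "a < 1"
  shows "(\<integral>\<^sup>+z. ennreal (z ^ (2 * k) * exp (a * z\<^sup>2 / 2)) \<partial>std_normal)
    = ennreal (fact (2 * k) / (2 ^ k * fact k) * (1 / (1 - a)) ^ k / sqrt (1 - a))"
proof -
  define \<sigma> where "\<sigma> = 1 / sqrt (1 - a)"
  have \<sigma>: "0 < \<sigma>" "\<sigma>\<^sup>2 = 1 / (1 - a)" using a by (simp_all add: \<sigma>_def power_divide)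
  have eq: "std_normal_density z * (z ^ (2 * k) * exp (a * z\<^sup>2 / 2)) = \<sigma> * (normal_density 0 \<sigma> z * (z - 0) ^ (2 * k))" for z
  proof -
    have e: "- z\<^sup>2 / 2 + a * z\<^sup>2 / 2 = - (z - 0)\<^sup>2 / (2 * \<sigma>\<^sup>2)"
      unfolding \<sigma>(2) using a by (simp add: field_simps power2_eq_square)
    have "exp (- z\<^sup>2 / 2) * exp (a * z\<^sup>2 / 2) = exp (- (z - 0)\<^sup>2 / (2 * \<sigma>\<^sup>2))"
      unfolding exp_add[symmetric] e ..
    moreover have "sqrt (2 * pi * \<sigma>\<^sup>2) = sqrt (2 * pi) * \<sigma>"
      using \<sigma>(1) by (simp add: real_sqrt_mult)
    ultimately show ?thesis
      using \<sigma>(1) by (simp add: normal_density_def field_simps)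
  qed
  have nn: "0 \<le> normal_density 0 \<sigma> z * (z - 0) ^ (2 * k)" for z
    by simp
  have "(\<integral>\<^sup>+z. ennreal (z ^ (2 * k) * exp (a * z\<^sup>2 / 2)) \<partial>std_normal)
     = (\<integral>\<^sup>+z. ennreal (std_normal_density z * (z ^ (2 * k) * exp (a * z\<^sup>2 / 2))) \<partial>lborel)"
    unfolding std_normal_def
    by (subst nn_integral_density) (auto simp: ennreal_mult)
  also have "\<dots> = (\<integral>\<^sup>+z. ennreal \<sigma> * ennreal (normal_density 0 \<sigma> z * (z - 0) ^ (2 * k)) \<partial>lborel)"
    unfolding eq using \<sigma>(1) nn by (intro nn_integral_cong ennreal_mult) auto
  also have "\<dots> = ennreal \<sigma> * (\<integral>\<^sup>+z. ennreal (normal_density 0 \<sigma> z * (z - 0) ^ (2 * k)) \<partial>lborel)"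
    by (rule nn_integral_cmult) auto
  also have "(\<integral>\<^sup>+z. ennreal (normal_density 0 \<sigma> z * (z - 0) ^ (2 * k)) \<partial>lborel)
     = ennreal (fact (2 * k) / ((2 / \<sigma>\<^sup>2) ^ k * fact k))"
    using normal_moment_even[OF \<sigma>(1), of 0 k] nn
    by (subst nn_integral_eq_integral) (auto simp: has_bochner_integral_iff)
  also have "ennreal \<sigma> * \<dots> = ennreal (\<sigma> * (fact (2 * k) / ((2 / \<sigma>\<^sup>2) ^ k * fact k)))"
    using \<sigma>(1) by (subst ennreal_mult) auto
  also have "\<sigma> * (fact (2 * k) / ((2 / \<sigma>\<^sup>2) ^ k * fact k)) = fact (2 * k) / (2 ^ k * fact k) * (1 / (1 - a)) ^ k / sqrt (1 - a)"
  proof -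
    have "2 / \<sigma>\<^sup>2 = 2 * (1 - a)" using a by (simp add: \<sigma>(2))
    then have "(2 / \<sigma>\<^sup>2) ^ k = 2 ^ k * (1 - a) ^ k" by (simp only: power_mult_distrib)
    then show ?thesis using a by (simp add: \<sigma>_def power_divide)
  qed
  finally show ?thesis .
qed

text \<open>A linear tilt shifts the mean to \<open>b\<close> and keeps the variance 1, so the
  second moment becomes \<open>1 + b^2\<close>.\<close>

lemma nn_integral_std_normal_sq_exp:
  "(\<integral>\<^sup>+z. ennreal (z\<^sup>2 * exp (b * z)) \<partial>std_normal) = ennreal ((1 + b\<^sup>2) * exp (b\<^sup>2 / 2))"
proof -
  let ?D = "normal_density b 1"
  have eq: "std_normal_density z * (z\<^sup>2 * exp (b * z)) = exp (b\<^sup>2 / 2) * (?D z * z\<^sup>2)" for z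
  proof -
    have e: "- z\<^sup>2 / 2 + b * z = b\<^sup>2 / 2 + - (z - b)\<^sup>2 / 2"
      by (simp add: field_simps power2_eq_square)
    have "exp (- z\<^sup>2 / 2) * exp (b * z) = exp (b\<^sup>2 / 2) * exp (- (z - b)\<^sup>2 / 2)"
      unfolding exp_add[symmetric] e ..
    then show ?thesis by (simp add: normal_density_def field_simps)
  qed
  \<comment> \<open>\<open>z^2 = (z - b)^2 + 2 b z - b^2\<close> reduces the raw second moment to
    the variance, the mean and the total mass.\<close>
  have "has_bochner_integral lborel (\<lambda>z. ?D z * (z - b) ^ (2 * 1) + 2 * b * (?D z * z) - b\<^sup>2 * ?D z) (1 + 2 * b * b - b\<^sup>2 * 1)"
    using normal_moment_even[of 1 b 1] normal_moment_nz_1[of 1 b] integral_normal_density[of 1 b] integrable_normal_density[of 1 b]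
    by (intro has_bochner_integral_diff has_bochner_integral_add has_bochner_integral_mult_right)
       (auto simp: has_bochner_integral_iff)
  also have "(\<lambda>z. ?D z * (z - b) ^ (2 * 1) + 2 * b * (?D z * z) - b\<^sup>2 * ?D z) = (\<lambda>z. ?D z * z\<^sup>2)"
    by (auto simp: fun_eq_iff power2_eq_square algebra_simps)
  also have "1 + 2 * b * b - b\<^sup>2 * 1 = 1 + b\<^sup>2"
    by (simp add: power2_eq_square)
  finally have hb: "has_bochner_integral lborel (\<lambda>z. ?D z * z\<^sup>2) (1 + b\<^sup>2)" .
  have "(\<integral>\<^sup>+z. ennreal (z\<^sup>2 * exp (b * z)) \<partial>std_normal)
     = (\<integral>\<^sup>+z. ennreal (std_normal_density z * (z\<^sup>2 * exp (b * z))) \<partial>lborel)"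
    unfolding std_normal_def by (subst nn_integral_density) (auto simp: ennreal_mult)
  also have "\<dots> = (\<integral>\<^sup>+z. ennreal (exp (b\<^sup>2 / 2)) * ennreal (?D z * z\<^sup>2) \<partial>lborel)"
    unfolding eq by (intro nn_integral_cong ennreal_mult) auto
  also have "\<dots> = ennreal (exp (b\<^sup>2 / 2)) * (\<integral>\<^sup>+z. ennreal (?D z * z\<^sup>2) \<partial>lborel)"
    by (rule nn_integral_cmult) auto
  also have "(\<integral>\<^sup>+z. ennreal (?D z * z\<^sup>2) \<partial>lborel) = ennreal (1 + b\<^sup>2)"
    using hb by (subst nn_integral_eq_integral) (auto simp: has_bochner_integral_iff)
  finally show ?thesis by (simp add: ennreal_mult mult.commute)
qed

lemma prob_space_std_normal: "prob_space std_normal"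
  using nn_integral_std_normal_exp[of 0 0] by (intro prob_spaceI) simp

lemma prob_space_gauss: "prob_space (gauss p)"
proof (rule prob_spaceI)
  interpret prob_space std_normal by (rule prob_space_std_normal)
  have "(\<integral>\<^sup>+x. (\<Prod>i<p. 1) \<partial>gauss p) = (\<Prod>i<p. \<integral>\<^sup>+x. 1 \<partial>std_normal)"
    by (rule nn_integral_gauss_prod) simp
  then show "emeasure (gauss p) (space (gauss p)) = 1" using emeasure_space_1 by simp
qed

lemma dot_self: "dot p x x = (nrm p x)\<^sup>2"
  by (simp add: dot_def nrm_sq flip: power2_eq_square)

lemma nn_integral_gauss_exp:
  "(\<integral>\<^sup>+x. ennreal (exp (dot p v x)) \<partial>gauss p) = ennreal (exp ((nrm p v)\<^sup>2 / 2))"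
proof -
  have "(\<integral>\<^sup>+x. ennreal (exp (dot p v x)) \<partial>gauss p) = (\<integral>\<^sup>+x. (\<Prod>i<p. ennreal (exp (v i * x i))) \<partial>gauss p)"
    by (simp add: dot_def exp_sum prod_ennreal)
  also have "\<dots> = (\<Prod>i<p. \<integral>\<^sup>+x. ennreal (exp (v i * x)) \<partial>std_normal)"
    by (rule nn_integral_gauss_prod) simp
  also have "\<dots> = (\<Prod>i<p. ennreal (exp ((v i)\<^sup>2 / 2)))"
    using nn_integral_std_normal_exp[of 0] by simp
  also have "\<dots> = ennreal (exp ((nrm p v)\<^sup>2 / 2))"
    by (simp add: nrm_sq sum_divide_distrib exp_sum prod_ennreal)
  finally show ?thesis .
qed

text \<open>The squared norm is summed coordinate by coordinate. In the term of index
  \<open>i\<close> only the \<open>i\<close>-th factor of the product integral changes, gaining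
  \<open>1 + (v i)^2\<close>.\<close>

lemma nn_integral_gauss_exp_nrm:
  "(\<integral>\<^sup>+x. ennreal (exp (dot p v x) * (nrm p x)\<^sup>2) \<partial>gauss p)
    = ennreal ((real p + (nrm p v)\<^sup>2) * exp ((nrm p v)\<^sup>2 / 2))"
proof -
  have 1: "(\<integral>\<^sup>+x. ennreal (exp (dot p v x) * (x i)\<^sup>2) \<partial>gauss p) = ennreal ((1 + (v i)\<^sup>2) * exp ((nrm p v)\<^sup>2 / 2))"
    if i: "i < p" for i
  proof -
    have E0: "(\<integral>\<^sup>+x. ennreal (exp (c * x)) \<partial>std_normal) = ennreal (exp (c\<^sup>2 / 2))" for c
      using nn_integral_std_normal_exp[of 0 c] by simp
    have E2: "(\<integral>\<^sup>+x. ennreal (exp (c * x)) * ennreal (x\<^sup>2) \<partial>std_normal) = ennreal (exp (c\<^sup>2 / 2)) * ennreal (1 + c\<^sup>2)" for c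
    proof -
      have "(\<integral>\<^sup>+x. ennreal (exp (c * x)) * ennreal (x\<^sup>2) \<partial>std_normal) = (\<integral>\<^sup>+x. ennreal (x\<^sup>2 * exp (c * x)) \<partial>std_normal)"
        by (intro nn_integral_cong) (simp add: ennreal_mult mult.commute)
      also have "\<dots> = ennreal (exp (c\<^sup>2 / 2)) * ennreal (1 + c\<^sup>2)"
        unfolding nn_integral_std_normal_sq_exp by (subst ennreal_mult) (auto simp: mult.commute)
      finally show ?thesis .
    qed
    have split: "(\<Prod>j<p. if j = i then g j * h j else g j) = (\<Prod>j<p. g j) * h i" for g h :: "nat \<Rightarrow> ennreal"
    proof -
      have "(\<Prod>j<p. if j = i then g j * h j else g j) = (\<Prod>j<p. g j * (if j = i then h j else 1))"
        by (intro prod.cong) auto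
      also have "\<dots> = (\<Prod>j<p. g j) * h i"
        using i by (simp add: prod.distrib)
      finally show ?thesis .
    qed
    have "(\<integral>\<^sup>+x. ennreal (exp (dot p v x) * (x i)\<^sup>2) \<partial>gauss p)
       = (\<integral>\<^sup>+x. (\<Prod>j<p. if j = i then ennreal (exp (v j * x j)) * ennreal ((x j)\<^sup>2) else ennreal (exp (v j * x j))) \<partial>gauss p)"
      unfolding split by (simp add: dot_def exp_sum prod_ennreal prod_nonneg ennreal_mult)
    also have "\<dots> = (\<Prod>j<p. \<integral>\<^sup>+x. (if j = i then ennreal (exp (v j * x)) * ennreal (x\<^sup>2) else ennreal (exp (v j * x))) \<partial>std_normal)"
      by (rule nn_integral_gauss_prod) simp
    also have "\<dots> = (\<Prod>j<p. if j = i then ennreal (exp ((v j)\<^sup>2 / 2)) * ennreal (1 + (v j)\<^sup>2) else ennreal (exp ((v j)\<^sup>2 / 2)))"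
      by (intro prod.cong refl) (simp add: E0 E2)
    also have "\<dots> = ennreal (exp ((nrm p v)\<^sup>2 / 2)) * ennreal (1 + (v i)\<^sup>2)"
      unfolding split by (simp add: nrm_sq sum_divide_distrib exp_sum prod_ennreal)
    also have "\<dots> = ennreal ((1 + (v i)\<^sup>2) * exp ((nrm p v)\<^sup>2 / 2))"
      by (subst ennreal_mult) (auto simp: mult.commute)
    finally show ?thesis .
  qed
  have "(\<integral>\<^sup>+x. ennreal (exp (dot p v x) * (nrm p x)\<^sup>2) \<partial>gauss p) = (\<integral>\<^sup>+x. (\<Sum>i<p. ennreal (exp (dot p v x) * (x i)\<^sup>2)) \<partial>gauss p)"
    by (intro nn_integral_cong) (simp add: nrm_sq sum_distrib_left sum_ennreal)
  also have "\<dots> = (\<Sum>i<p. \<integral>\<^sup>+x. ennreal (exp (dot p v x) * (x i)\<^sup>2) \<partial>gauss p)"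
    by (rule nn_integral_sum) auto
  also have "\<dots> = (\<Sum>i<p. ennreal ((1 + (v i)\<^sup>2) * exp ((nrm p v)\<^sup>2 / 2)))"
    using 1 by simp
  also have "\<dots> = ennreal ((real p + (nrm p v)\<^sup>2) * exp ((nrm p v)\<^sup>2 / 2))"
    by (simp add: nrm_sq[of p v] sum_ennreal sum_distrib_right[symmetric] sum.distrib)
  finally show ?thesis .
qed

section \<open>Linearising squared projections with an auxiliary Gaussian variable\<close>

lemma gauss_fubini:
  assumes f: "(\<lambda>(x, z). f x z) \<in> borel_measurable (Rn p \<Otimes>\<^sub>M borel)"
  shows "(\<integral>\<^sup>+x. (\<integral>\<^sup>+z. f x z \<partial>std_normal) \<partial>gauss p) = (\<integral>\<^sup>+z. (\<integral>\<^sup>+x. f x z \<partial>gauss p) \<partial>std_normal)"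
proof -
  interpret N: prob_space std_normal by (rule prob_space_std_normal)
  interpret G: prob_space "gauss p" by (rule prob_space_gauss)
  interpret pair_sigma_finite "gauss p" std_normal ..
  have "sets (gauss p \<Otimes>\<^sub>M std_normal) = sets (Rn p \<Otimes>\<^sub>M borel)"
    by (intro sets_pair_measure_cong) auto
  then have "(\<lambda>(x, z). f x z) \<in> borel_measurable (gauss p \<Otimes>\<^sub>M std_normal)"
    using f by (simp cong: measurable_cong_sets)
  from Fubini'[OF this] show ?thesis by simp
qed

lemma hubbard_stratonovich:
  assumes "0 \<le> s"
  shows "ennreal (exp (s * u\<^sup>2 / 2)) = (\<integral>\<^sup>+z. ennreal (exp (sqrt s * z * u)) \<partial>std_normal)"
  using nn_integral_std_normal_exp[of 0 "sqrt s * u"] assms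
  by (simp add: power_mult_distrib mult.commute mult.left_commute)

text \<open>Giving the auxiliary variable the weight \<open>z^2\<close> produces the factor
  \<open>1 + s * u^2\<close>. With \<open>U = s * u^2 / 2\<close> this is
  \<open>(1 + 2 * U) * exp U\<close>, from which the term \<open>U * exp U\<close> of the lower
  bound on the Watson normaliser is recovered.\<close>

lemma hubbard_stratonovich_sq:
  assumes "0 \<le> s"
  shows "ennreal ((1 + s * u\<^sup>2) * exp (s * u\<^sup>2 / 2)) = (\<integral>\<^sup>+z. ennreal (z\<^sup>2 * exp (sqrt s * z * u)) \<partial>std_normal)"
  using nn_integral_std_normal_sq_exp[of "sqrt s * u"] assms
  by (simp add: power_mult_distrib mult.commute mult.left_commute)


lemma dot_cmult: "dot p (\<lambda>i. c * v i) x = c * dot p v x"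
  by (simp add: dot_def sum_distrib_left mult.assoc)

lemma dot_add: "dot p (\<lambda>i. v i + w i) x = dot p v x + dot p w x"
  by (simp add: dot_def sum.distrib distrib_right)

lemma nrm_sq_cmult: "(nrm p (\<lambda>i. c * v i))\<^sup>2 = c\<^sup>2 * (nrm p v)\<^sup>2"
  by (simp add: nrm_sq power_mult_distrib sum_distrib_left)

lemma nn_integral_gauss_exp_dir:
  assumes "nrm p v = 1"
  shows "(\<integral>\<^sup>+x. ennreal (exp (c * dot p v x)) \<partial>gauss p) = ennreal (exp (c\<^sup>2 / 2))"
  using nn_integral_gauss_exp[of p "\<lambda>i. c * v i"] assms by (simp add: dot_cmult nrm_sq_cmult)

lemma nn_integral_gauss_exp_nrm_dir:
  assumes "nrm p v = 1"
  shows "(\<integral>\<^sup>+x. ennreal (exp (c * dot p v x)) * ennreal ((nrm p x)\<^sup>2) \<partial>gauss p)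
    = ennreal ((real p + c\<^sup>2) * exp (c\<^sup>2 / 2))"
  using nn_integral_gauss_exp_nrm[of p "\<lambda>i. c * v i"] assms
  by (simp add: dot_cmult nrm_sq_cmult ennreal_mult)

text \<open>The free factor \<open>g\<close> carries either the squared norm or a second squared
  exponential. After the exchange of integrals the projection on \<open>v\<close> occurs only
  linearly in an exponent.\<close>

lemma gauss_hubbard:
  assumes s: "0 \<le> s" and [measurable]: "g \<in> borel_measurable (Rn p)"
  shows "(\<integral>\<^sup>+x. ennreal (exp (s * (dot p v x)\<^sup>2 / 2)) * g x \<partial>gauss p)
    = (\<integral>\<^sup>+z. (\<integral>\<^sup>+x. ennreal (exp (sqrt s * z * dot p v x)) * g x \<partial>gauss p) \<partial>std_normal)"
proof -
  have "(\<integral>\<^sup>+x. ennreal (exp (s * (dot p v x)\<^sup>2 / 2)) * g x \<partial>gauss p)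
     = (\<integral>\<^sup>+x. (\<integral>\<^sup>+z. ennreal (exp (sqrt s * z * dot p v x)) * g x \<partial>std_normal) \<partial>gauss p)"
    unfolding hubbard_stratonovich[OF s] by (intro nn_integral_cong nn_integral_multc[symmetric]) auto
  also have "\<dots> = (\<integral>\<^sup>+z. (\<integral>\<^sup>+x. ennreal (exp (sqrt s * z * dot p v x)) * g x \<partial>gauss p) \<partial>std_normal)"
    by (rule gauss_fubini) measurable
  finally show ?thesis .
qed

lemma gauss_hubbard_sq:
  assumes s: "0 \<le> s" and [measurable]: "g \<in> borel_measurable (Rn p)"
  shows "(\<integral>\<^sup>+x. ennreal ((1 + s * (dot p v x)\<^sup>2) * exp (s * (dot p v x)\<^sup>2 / 2)) * g x \<partial>gauss p)
    = (\<integral>\<^sup>+z. ennreal (z\<^sup>2) * (\<integral>\<^sup>+x. ennreal (exp (sqrt s * z * dot p v x)) * g x \<partial>gauss p) \<partial>std_normal)"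
proof -
  have "(\<integral>\<^sup>+x. ennreal ((1 + s * (dot p v x)\<^sup>2) * exp (s * (dot p v x)\<^sup>2 / 2)) * g x \<partial>gauss p)
     = (\<integral>\<^sup>+x. (\<integral>\<^sup>+z. ennreal (z\<^sup>2 * exp (sqrt s * z * dot p v x)) * g x \<partial>std_normal) \<partial>gauss p)"
    unfolding hubbard_stratonovich_sq[OF s] by (intro nn_integral_cong nn_integral_multc[symmetric]) auto
  also have "\<dots> = (\<integral>\<^sup>+z. (\<integral>\<^sup>+x. ennreal (z\<^sup>2 * exp (sqrt s * z * dot p v x)) * g x \<partial>gauss p) \<partial>std_normal)"
    by (rule gauss_fubini) measurable
  also have "\<dots> = (\<integral>\<^sup>+z. ennreal (z\<^sup>2) * (\<integral>\<^sup>+x. ennreal (exp (sqrt s * z * dot p v x)) * g x \<partial>gauss p) \<partial>std_normal)"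
    by (intro nn_integral_cong) (simp add: ennreal_mult mult.assoc nn_integral_cmult)
  finally show ?thesis .
qed

lemma nn_integral_std_normal_moment_sum:
  assumes a: "a < 1" and "0 \<le> A" "0 \<le> B"
  shows "(\<integral>\<^sup>+z. ennreal ((A * z ^ (2 * j) + B * z ^ (2 * k)) * exp (a * z\<^sup>2 / 2)) \<partial>std_normal)
    = ennreal (A * (fact (2 * j) / (2 ^ j * fact j) * (1 / (1 - a)) ^ j / sqrt (1 - a))
       + B * (fact (2 * k) / (2 ^ k * fact k) * (1 / (1 - a)) ^ k / sqrt (1 - a)))"
proof -
  have nn: "0 \<le> z ^ (2 * i)" for z :: real and i :: nat
    by simp
  have "ennreal ((A * z ^ (2 * j) + B * z ^ (2 * k)) * exp (a * z\<^sup>2 / 2))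
     = ennreal A * ennreal (z ^ (2 * j) * exp (a * z\<^sup>2 / 2)) + ennreal B * ennreal (z ^ (2 * k) * exp (a * z\<^sup>2 / 2))" for z
    using assms nn[of z j] nn[of z k]
    by (simp add: ennreal_mult[symmetric] ennreal_plus[symmetric] distrib_right mult.assoc del: ennreal_plus)
  then have "(\<integral>\<^sup>+z. ennreal ((A * z ^ (2 * j) + B * z ^ (2 * k)) * exp (a * z\<^sup>2 / 2)) \<partial>std_normal)
    = ennreal A * (\<integral>\<^sup>+z. ennreal (z ^ (2 * j) * exp (a * z\<^sup>2 / 2)) \<partial>std_normal)
      + ennreal B * (\<integral>\<^sup>+z. ennreal (z ^ (2 * k) * exp (a * z\<^sup>2 / 2)) \<partial>std_normal)"
    by (simp add: nn_integral_add nn_integral_cmult del: ennreal_plus)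
  then show ?thesis
    using assms
    unfolding nn_integral_std_normal_moment_exp[OF a]
    by (simp add: ennreal_mult[symmetric] ennreal_plus[symmetric] del: ennreal_plus)
qed

section \<open>Gaussian integrals of one squared projection, with and without the weight
  |x|^2\<close>

context
  fixes p :: nat and v :: "nat \<Rightarrow> real" and s :: real
  assumes v: "nrm p v = 1" and s: "0 \<le> s" "s < 1"
begin

lemma gauss_mgf:
  "(\<integral>\<^sup>+x. ennreal (exp (s * (dot p v x)\<^sup>2 / 2)) \<partial>gauss p) = ennreal (1 / sqrt (1 - s))"
proof -
  have "(\<integral>\<^sup>+x. ennreal (exp (s * (dot p v x)\<^sup>2 / 2)) \<partial>gauss p)
      = (\<integral>\<^sup>+z. ennreal (exp (s * z\<^sup>2 / 2)) \<partial>std_normal)"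
    using gauss_hubbard[OF s(1), of "\<lambda>_. 1" p v] s(1)
    by (simp add: nn_integral_gauss_exp_dir[OF v] power_mult_distrib)
  then show ?thesis using nn_integral_std_normal_exp[OF s(2), of 0] by simp
qed

lemma gauss_mgf_nrm:
  "(\<integral>\<^sup>+x. ennreal (exp (s * (dot p v x)\<^sup>2 / 2)) * ennreal ((nrm p x)\<^sup>2) \<partial>gauss p)
    = ennreal ((p + s / (1 - s)) / sqrt (1 - s))"
proof -
  have "(\<integral>\<^sup>+x. ennreal (exp (s * (dot p v x)\<^sup>2 / 2)) * ennreal ((nrm p x)\<^sup>2) \<partial>gauss p)
      = (\<integral>\<^sup>+z. ennreal ((real p * z ^ (2 * 0) + s * z ^ (2 * 1)) * exp (s * z\<^sup>2 / 2)) \<partial>std_normal)"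
    using s(1)
    by (subst gauss_hubbard[OF s(1)]) (auto simp: nn_integral_gauss_exp_nrm_dir[OF v] power_mult_distrib)
  also have "\<dots> = ennreal ((p + s / (1 - s)) / sqrt (1 - s))"
    unfolding nn_integral_std_normal_moment_sum[OF s(2) of_nat_0_le_iff s(1)]
    by (simp add: add_divide_distrib)
  finally show ?thesis .
qed

lemma gauss_mgf_sq:
  "(\<integral>\<^sup>+x. ennreal ((1 + s * (dot p v x)\<^sup>2) * exp (s * (dot p v x)\<^sup>2 / 2)) \<partial>gauss p)
    = ennreal (1 / (1 - s) / sqrt (1 - s))"
proof -
  have "(\<integral>\<^sup>+x. ennreal ((1 + s * (dot p v x)\<^sup>2) * exp (s * (dot p v x)\<^sup>2 / 2)) \<partial>gauss p)
      = (\<integral>\<^sup>+z. ennreal (z\<^sup>2) * ennreal (exp (s * z\<^sup>2 / 2)) \<partial>std_normal)"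
    using gauss_hubbard_sq[OF s(1), of "\<lambda>_. 1" p v] s(1)
    by (simp add: nn_integral_gauss_exp_dir[OF v] power_mult_distrib)
  also have "\<dots> = (\<integral>\<^sup>+z. ennreal (z ^ (2 * 1) * exp (s * z\<^sup>2 / 2)) \<partial>std_normal)"
    by (simp add: ennreal_mult)
  also have "\<dots> = ennreal (1 / (1 - s) / sqrt (1 - s))"
    unfolding nn_integral_std_normal_moment_exp[OF s(2)] by simp
  finally show ?thesis .
qed

lemma gauss_mgf_sq_nrm:
  "(\<integral>\<^sup>+x. ennreal ((1 + s * (dot p v x)\<^sup>2) * exp (s * (dot p v x)\<^sup>2 / 2)) * ennreal ((nrm p x)\<^sup>2) \<partial>gauss p)
    = ennreal ((p / (1 - s) + 3 * s / (1 - s)\<^sup>2) / sqrt (1 - s))"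
proof -
  have "(\<integral>\<^sup>+x. ennreal ((1 + s * (dot p v x)\<^sup>2) * exp (s * (dot p v x)\<^sup>2 / 2)) * ennreal ((nrm p x)\<^sup>2) \<partial>gauss p)
      = (\<integral>\<^sup>+z. ennreal (z\<^sup>2) * ennreal ((real p + s * z\<^sup>2) * exp (s * z\<^sup>2 / 2)) \<partial>std_normal)"
    using s(1)
    by (subst gauss_hubbard_sq[OF s(1)]) (auto simp: nn_integral_gauss_exp_nrm_dir[OF v] power_mult_distrib)
  also have "\<dots> = (\<integral>\<^sup>+z. ennreal ((real p * z ^ (2 * 1) + s * z ^ (2 * 2)) * exp (s * z\<^sup>2 / 2)) \<partial>std_normal)"
  proof (intro nn_integral_cong)
    fix z :: real
    have "z\<^sup>2 * ((real p + s * z\<^sup>2) * exp (s * z\<^sup>2 / 2)) = (real p * z ^ (2 * 1) + s * z ^ (2 * 2)) * exp (s * z\<^sup>2 / 2)"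
      by (simp add: algebra_simps power_numeral_reduce)
    then show "ennreal (z\<^sup>2) * ennreal ((real p + s * z\<^sup>2) * exp (s * z\<^sup>2 / 2))
      = ennreal ((real p * z ^ (2 * 1) + s * z ^ (2 * 2)) * exp (s * z\<^sup>2 / 2))"
      using s(1) by (metis ennreal_mult'' zero_le_power2 ennreal_mult mult.commute)
  qed
  also have "\<dots> = ennreal ((p / (1 - s) + 3 * s / (1 - s)\<^sup>2) / sqrt (1 - s))"
    unfolding nn_integral_std_normal_moment_sum[OF s(2) of_nat_0_le_iff s(1)]
    by (simp add: add_divide_distrib fact_numeral power_divide mult.commute)
  finally show ?thesis .
qed

end

text \<open>The quantity under the root is the determinant of \<open>I - s G\<close>, where
  \<open>G\<close> is the Gram matrix of \<open>v\<close> and \<open>w\<close>; its eigenvalues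
  \<open>1 - s (1 + \<rho>)\<close> and \<open>1 - s (1 - \<rho>)\<close> are positive by the last
  assumption. The two squares are linearised in turn, and the two one-dimensional integrations
  produce the pivots \<open>1 - s\<close> and \<open>1 - a\<close>, whose product is the
  determinant.\<close>

lemma gauss_mgf_pair:
  assumes v: "nrm p v = 1" and w: "nrm p w = 1"
    and s: "0 \<le> s" "s < 1" and r: "s * \<bar>dot p v w\<bar> < 1 - s"
  shows "(\<integral>\<^sup>+x. ennreal (exp (s * ((dot p v x)\<^sup>2 + (dot p w x)\<^sup>2) / 2)) \<partial>gauss p)
    = ennreal (1 / sqrt ((1 - s)\<^sup>2 - s\<^sup>2 * (dot p v w)\<^sup>2))"
proof -
  define \<rho> where "\<rho> = dot p v w"
  have r': "s * \<bar>\<rho>\<bar> < 1 - s" using r by (simp add: \<rho>_def)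
  have lt: "s\<^sup>2 * \<rho>\<^sup>2 < (1 - s)\<^sup>2"
  proof -
    have "(s * \<bar>\<rho>\<bar>)\<^sup>2 < (1 - s)\<^sup>2"
      using r' s by (intro power_strict_mono) auto
    then show ?thesis by (simp add: power_mult_distrib)
  qed
  have nvw: "(nrm p (\<lambda>i. a * v i + b * w i))\<^sup>2 = a\<^sup>2 + b\<^sup>2 + 2 * a * b * \<rho>" for a b
  proof -
    have "(nrm p (\<lambda>i. a * v i + b * w i))\<^sup>2 = a\<^sup>2 * dot p v v + b\<^sup>2 * dot p w w + 2 * a * b * dot p v w"
      unfolding nrm_sq dot_def
      by (simp add: sum_distrib_left sum.distrib[symmetric] power2_eq_square algebra_simps)
    then show ?thesis using v w by (simp add: dot_self \<rho>_def)
  qed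
  have in1: "(\<integral>\<^sup>+x. ennreal (exp (sqrt s * z * dot p v x)) * ennreal (exp (s * (dot p w x)\<^sup>2 / 2)) \<partial>gauss p)
     = ennreal (exp (s * z\<^sup>2 / 2)) * ennreal (exp ((s * \<rho> * z)\<^sup>2 / (2 * (1 - s))) / sqrt (1 - s))" for z
  proof -
    have "(\<integral>\<^sup>+x. ennreal (exp (sqrt s * z * dot p v x)) * ennreal (exp (s * (dot p w x)\<^sup>2 / 2)) \<partial>gauss p)
      = (\<integral>\<^sup>+x. ennreal (exp (s * (dot p w x)\<^sup>2 / 2)) * ennreal (exp (sqrt s * z * dot p v x)) \<partial>gauss p)"
      by (simp add: mult.commute)
    also have "\<dots> = (\<integral>\<^sup>+y. (\<integral>\<^sup>+x. ennreal (exp (sqrt s * y * dot p w x)) * ennreal (exp (sqrt s * z * dot p v x)) \<partial>gauss p) \<partial>std_normal)"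
      by (rule gauss_hubbard[OF s(1)]) measurable
    also have "\<dots> = (\<integral>\<^sup>+y. ennreal (exp (s * z\<^sup>2 / 2)) * ennreal (exp (s * y\<^sup>2 / 2 + s * \<rho> * z * y)) \<partial>std_normal)"
    proof (intro nn_integral_cong)
      fix y
      have "(\<integral>\<^sup>+x. ennreal (exp (sqrt s * y * dot p w x)) * ennreal (exp (sqrt s * z * dot p v x)) \<partial>gauss p)
        = (\<integral>\<^sup>+x. ennreal (exp (dot p (\<lambda>i. (sqrt s * z) * v i + (sqrt s * y) * w i) x)) \<partial>gauss p)"
        by (simp add: dot_add dot_cmult ennreal_mult[symmetric] exp_add[symmetric] add.commute)
      also have "\<dots> = ennreal (exp ((s * z\<^sup>2 + s * y\<^sup>2 + 2 * s * z * y * \<rho>) / 2))"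
        unfolding nn_integral_gauss_exp nvw using s(1)
        by (simp add: power_mult_distrib algebra_simps flip: real_sqrt_mult) 
      also have "\<dots> = ennreal (exp (s * z\<^sup>2 / 2)) * ennreal (exp (s * y\<^sup>2 / 2 + s * \<rho> * z * y))"
        by (simp add: ennreal_mult[symmetric] exp_add[symmetric] add_divide_distrib algebra_simps)
      finally show "(\<integral>\<^sup>+x. ennreal (exp (sqrt s * y * dot p w x)) * ennreal (exp (sqrt s * z * dot p v x)) \<partial>gauss p)
         = ennreal (exp (s * z\<^sup>2 / 2)) * ennreal (exp (s * y\<^sup>2 / 2 + s * \<rho> * z * y))" .
    qed
    also have "\<dots> = ennreal (exp (s * z\<^sup>2 / 2)) * ennreal (exp ((s * \<rho> * z)\<^sup>2 / (2 * (1 - s))) / sqrt (1 - s))"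
      by (subst nn_integral_cmult) (auto simp: nn_integral_std_normal_exp[OF s(2)])
    finally show ?thesis .
  qed
  \<comment> \<open>The coefficient of \<open>z^2 / 2\<close> left after the integration over
    \<open>y\<close>: \<open>s\<close> comes from \<open>v\<close> itself, the second term from its
    correlation with \<open>w\<close>.\<close>
  define a where "a = s + s\<^sup>2 * \<rho>\<^sup>2 / (1 - s)"
  have a1: "1 - a = ((1 - s)\<^sup>2 - s\<^sup>2 * \<rho>\<^sup>2) / (1 - s)"
    using s by (simp add: a_def field_simps power2_eq_square)
  have a: "a < 1"
  proof -
    have "0 < 1 - a" unfolding a1 using lt s by (intro divide_pos_pos) auto
    then show ?thesis by simp
  qed
  have "(\<integral>\<^sup>+x. ennreal (exp (s * ((dot p v x)\<^sup>2 + (dot p w x)\<^sup>2) / 2)) \<partial>gauss p)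
     = (\<integral>\<^sup>+x. ennreal (exp (s * (dot p v x)\<^sup>2 / 2)) * ennreal (exp (s * (dot p w x)\<^sup>2 / 2)) \<partial>gauss p)"
    by (simp add: ennreal_mult[symmetric] exp_add[symmetric] distrib_left add_divide_distrib)
  also have "\<dots> = (\<integral>\<^sup>+z. (\<integral>\<^sup>+x. ennreal (exp (sqrt s * z * dot p v x)) * ennreal (exp (s * (dot p w x)\<^sup>2 / 2)) \<partial>gauss p) \<partial>std_normal)"
    by (rule gauss_hubbard[OF s(1)]) measurable
  also have "\<dots> = (\<integral>\<^sup>+z. ennreal (1 / sqrt (1 - s)) * ennreal (exp (a * z\<^sup>2 / 2 + 0 * z)) \<partial>std_normal)"
  proof (intro nn_integral_cong)
    fix z
    have "s * z\<^sup>2 / 2 + (s * \<rho> * z)\<^sup>2 / (2 * (1 - s)) = a * z\<^sup>2 / 2 + 0 * z"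
      using s by (simp add: a_def field_simps power2_eq_square)
    then have "exp (s * z\<^sup>2 / 2) * exp ((s * \<rho> * z)\<^sup>2 / (2 * (1 - s))) = exp (a * z\<^sup>2 / 2 + 0 * z)"
      by (simp only: exp_add[symmetric])
    then show "(\<integral>\<^sup>+x. ennreal (exp (sqrt s * z * dot p v x)) * ennreal (exp (s * (dot p w x)\<^sup>2 / 2)) \<partial>gauss p)
       = ennreal (1 / sqrt (1 - s)) * ennreal (exp (a * z\<^sup>2 / 2 + 0 * z))"
      unfolding in1 using s by (simp add: ennreal_mult[symmetric])
  qed
  also have "\<dots> = ennreal (1 / sqrt (1 - s)) * ennreal (1 / sqrt (1 - a))"
    by (subst nn_integral_cmult) (auto simp: nn_integral_std_normal_exp[OF a, of 0, simplified])
  also have "\<dots> = ennreal (1 / sqrt ((1 - s)\<^sup>2 - s\<^sup>2 * \<rho>\<^sup>2))"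
    unfolding a1 using s lt by (simp add: ennreal_mult[symmetric] real_sqrt_divide)
  finally show ?thesis unfolding \<rho>_def .
qed

subsection \<open>Exponential moments on the sphere\<close>

lemma measurable_gauss [simp]: "measurable (gauss p) M = measurable (Rn p) M"
  by (rule measurable_cong_sets) auto

lemma measurable_unif_sphere [simp]: "measurable (unif_sphere p) M = measurable (sphere_borel p) M"
  by (rule measurable_cong_sets) auto

lemma gauss_density_nrm:
  "(\<Prod>i<p. ennreal (std_normal_density (x i))) = ennreal ((1 / sqrt (2 * pi)) ^ p * exp (- (nrm p x)\<^sup>2 / 2))"
proof -
  have "(\<Prod>i<p. std_normal_density (x i)) = (1 / sqrt (2 * pi)) ^ p * (\<Prod>i<p. exp (- (x i)\<^sup>2 / 2))"
    by (simp add: std_normal_density_def prod.distrib power_divide prod_dividef)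
  also have "(\<Prod>i<p. exp (- (x i)\<^sup>2 / 2)) = exp (- (nrm p x)\<^sup>2 / 2)"
    by (simp add: nrm_sq exp_sum[symmetric] sum_divide_distrib sum_negf)
  finally show ?thesis by (simp add: prod_ennreal)
qed

lemma polar_gauss:
  assumes p: "0 < p" and [measurable]: "f \<in> borel_measurable (Rn p)" "w \<in> borel_measurable borel"
  shows "(\<integral>\<^sup>+x. f (normalise p x) * w (nrm p x) \<partial>gauss p)
    = (\<integral>\<^sup>+y. f y \<partial>unif_sphere p) * (\<integral>\<^sup>+x. w (nrm p x) \<partial>gauss p)"
proof -
  define g where "g r = ennreal ((1 / sqrt (2 * pi)) ^ p * exp (- r\<^sup>2 / 2))" for r :: real
  have [measurable]: "g \<in> borel_measurable borel" unfolding g_def by measurable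
  have G: "gauss p = density (leb p) (\<lambda>x. g (nrm p x))"
    unfolding gauss_def g_def gauss_density_nrm ..
  have "(\<integral>\<^sup>+x. f (normalise p x) * w (nrm p x) \<partial>gauss p)
     = (\<integral>\<^sup>+x. f (normalise p x) * (g (nrm p x) * w (nrm p x)) \<partial>leb p)"
    unfolding G by (subst nn_integral_density) (auto simp: ac_simps)
  also have "\<dots> = (\<integral>\<^sup>+y. f y \<partial>unif_sphere p) * (\<integral>\<^sup>+x. g (nrm p x) * w (nrm p x) \<partial>leb p)"
    by (rule polar_unif_sphere[OF p, where w = "\<lambda>r. g r * w r"]) measurable
  also have "(\<integral>\<^sup>+x. g (nrm p x) * w (nrm p x) \<partial>leb p) = (\<integral>\<^sup>+x. w (nrm p x) \<partial>gauss p)"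
    unfolding G by (subst nn_integral_density) auto
  finally show ?thesis .
qed

lemma nn_integral_gauss_nrm: "(\<integral>\<^sup>+x. ennreal ((nrm p x)\<^sup>2) \<partial>gauss p) = ennreal p"
proof -
  have "nrm p (\<lambda>_. 0) = 0" by (simp add: nrm_def L2_set_def)
  then show ?thesis using nn_integral_gauss_exp_nrm[of p "\<lambda>_. 0"] by (simp add: dot_def)
qed

lemma AE_gauss_nrm_pos: "0 < p \<Longrightarrow> AE x in gauss p. 0 < nrm p x"
  unfolding gauss_def using AE_leb_nrm_pos[of p]
  by (subst AE_density) (auto elim: eventually_mono)

lemma prob_space_unif_sphere:
  assumes "0 < p"
  shows "prob_space (unif_sphere p)"
proof (rule prob_spaceI)
  interpret G: prob_space "gauss p" by (rule prob_space_gauss)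
  have "(\<integral>\<^sup>+x. 1 * 1 \<partial>gauss p) = (\<integral>\<^sup>+y. 1 \<partial>unif_sphere p) * (\<integral>\<^sup>+x. 1 \<partial>gauss p)"
    by (rule polar_gauss[OF assms, where f = "\<lambda>_. 1" and w = "\<lambda>_. 1"]) auto
  then show "emeasure (unif_sphere p) (space (unif_sphere p)) = 1"
    using G.emeasure_space_1 by simp
qed

text \<open>Two Gaussian expressions for the same spherical integral: the weight |x|^2 / p has mean
  1 and is independent of the direction. Choosing for each term whether to carry the weight is what
  makes the tangent-line bounds below balance.\<close>

lemma polar_gauss_mean:
  assumes p: "0 < p" and f [measurable]: "f \<in> borel_measurable (Rn p)"
  shows "(\<integral>\<^sup>+x. f (normalise p x) \<partial>gauss p) = (\<integral>\<^sup>+y. f y \<partial>unif_sphere p)"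
    and "(\<integral>\<^sup>+x. f (normalise p x) * ennreal ((nrm p x)\<^sup>2 / p) \<partial>gauss p) = (\<integral>\<^sup>+y. f y \<partial>unif_sphere p)"
proof -
  interpret G: prob_space "gauss p" by (rule prob_space_gauss)
  show "(\<integral>\<^sup>+x. f (normalise p x) \<partial>gauss p) = (\<integral>\<^sup>+y. f y \<partial>unif_sphere p)"
    using polar_gauss[OF p f, of "\<lambda>_. 1"] G.emeasure_space_1 by simp
  have "ennreal ((nrm p x)\<^sup>2 / p) = ennreal (1 / p) * ennreal ((nrm p x)\<^sup>2)" for x
    by (simp add: ennreal_mult[symmetric])
  then have "(\<integral>\<^sup>+x. ennreal ((nrm p x)\<^sup>2 / p) \<partial>gauss p) = ennreal (1 / p) * ennreal p"
    by (simp add: nn_integral_cmult nn_integral_gauss_nrm)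
  also have "\<dots> = 1" using p by (simp add: ennreal_mult[symmetric])
  finally show "(\<integral>\<^sup>+x. f (normalise p x) * ennreal ((nrm p x)\<^sup>2 / p) \<partial>gauss p) = (\<integral>\<^sup>+y. f y \<partial>unif_sphere p)"
    using polar_gauss[OF p f, of "\<lambda>r. ennreal (r\<^sup>2 / p)"] by simp
qed

lemma dot_normalise: "dot p v (normalise p x) = dot p v x / nrm p x"
  by (simp add: dot_def normalise_def nrm_def sum_divide_distrib)

text \<open>
  Jensen's inequality in the length of \<open>g\<close>, whose mean square is \<open>p\<close>. It enters through the tangent
  \<open>e\<^sup>Q (1 + (Q R - Q)) \<le> e\<^sup>Q\<^sup>R\<close>, \<open>R = |g|\<^sup>2 / p\<close>, with the negative term moved across so that all
  integrands are nonnegative.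
\<close>

lemma sphere_exp_le_gauss:
  assumes p: "0 < p" and [measurable]: "q \<in> borel_measurable (Rn p)"
    and hom: "\<And>x. x \<in> space (Rn p) \<Longrightarrow> 0 < nrm p x \<Longrightarrow> q x = (nrm p x)\<^sup>2 * q (normalise p x)"
    and bnd: "\<And>y. y \<in> usphere p \<Longrightarrow> 0 \<le> q y \<and> q y \<le> C"
  shows "(\<integral>\<^sup>+y. ennreal (exp (q y)) \<partial>unif_sphere p) \<le> (\<integral>\<^sup>+x. ennreal (exp (q x / p)) \<partial>gauss p)"
proof -
  interpret U: prob_space "unif_sphere p" by (rule prob_space_unif_sphere[OF p])
  define I where "I = (\<integral>\<^sup>+y. ennreal (q y * exp (q y)) \<partial>unif_sphere p)"
  have "I \<le> (\<integral>\<^sup>+y. ennreal (C * exp C) \<partial>unif_sphere p)"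
    unfolding I_def
  proof (rule nn_integral_mono)
    fix y assume "y \<in> space (unif_sphere p)"
    then have "0 \<le> q y" "q y \<le> C" using bnd by auto
    then have "q y * exp (q y) \<le> C * exp C" by (intro mult_mono) auto
    then show "ennreal (q y * exp (q y)) \<le> ennreal (C * exp C)" by (rule ennreal_leI)
  qed
  \<comment> \<open>\<open>I\<close> is going to be cancelled from both sides of an inequality in
    the extended reals, which requires it to be finite; the bound \<open>C\<close> on the sphere
    guarantees this.\<close>
  then have fin: "I \<noteq> \<infinity>"
    using U.emeasure_space_1 by (auto simp: top_unique)
  have "(\<integral>\<^sup>+y. ennreal (exp (q y)) \<partial>unif_sphere p) + I
     = (\<integral>\<^sup>+x. ennreal (exp (q (normalise p x))) \<partial>gauss p)
        + (\<integral>\<^sup>+x. ennreal (q (normalise p x) * exp (q (normalise p x))) * ennreal ((nrm p x)\<^sup>2 / p) \<partial>gauss p)"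
    unfolding I_def
    by (subst polar_gauss_mean(1)[OF p], measurable, subst polar_gauss_mean(2)[OF p], measurable)
  also have "\<dots> = (\<integral>\<^sup>+x. ennreal (exp (q (normalise p x)))
       + ennreal (q (normalise p x) * exp (q (normalise p x))) * ennreal ((nrm p x)\<^sup>2 / p) \<partial>gauss p)"
    by (rule nn_integral_add[symmetric]) auto
  also have "\<dots> \<le> (\<integral>\<^sup>+x. ennreal (exp (q x / p)) + ennreal (q (normalise p x) * exp (q (normalise p x))) \<partial>gauss p)"
  proof (rule nn_integral_mono_AE)
    show "AE x in gauss p. ennreal (exp (q (normalise p x)))
       + ennreal (q (normalise p x) * exp (q (normalise p x))) * ennreal ((nrm p x)\<^sup>2 / p)
       \<le> ennreal (exp (q x / p)) + ennreal (q (normalise p x) * exp (q (normalise p x)))"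
      using AE_gauss_nrm_pos[OF p] AE_space[of "gauss p"]
    proof eventually_elim
      case (elim x)
      define Q where "Q = q (normalise p x)"
      define R where "R = (nrm p x)\<^sup>2 / p"
      have Q: "0 \<le> Q" using bnd normalise_usphere[OF elim(1)] by (simp add: Q_def)
      have R: "0 \<le> R" by (simp add: R_def)
      have qx: "q x / p = Q * R" using hom[of x] elim by (simp add: Q_def R_def)
      have "exp Q * (1 + (Q * R - Q)) \<le> exp Q * exp (Q * R - Q)"
        by (intro mult_left_mono exp_ge_add_one_self) auto
      also have "\<dots> = exp (Q * R)" by (simp add: exp_add[symmetric])
      finally have "exp Q + Q * exp Q * R \<le> exp (Q * R) + Q * exp Q"
        by (simp add: algebra_simps)
      then have "ennreal (exp Q + Q * exp Q * R) \<le> ennreal (exp (Q * R) + Q * exp Q)"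
        by (rule ennreal_leI)
      then show ?case
        unfolding Q_def[symmetric] R_def[symmetric] qx using Q R
        by (simp add: ennreal_mult)
    qed
  qed
  also have "\<dots> = (\<integral>\<^sup>+x. ennreal (exp (q x / p)) \<partial>gauss p) + (\<integral>\<^sup>+x. ennreal (q (normalise p x) * exp (q (normalise p x))) \<partial>gauss p)"
    by (rule nn_integral_add) auto
  also have "(\<integral>\<^sup>+x. ennreal (q (normalise p x) * exp (q (normalise p x))) \<partial>gauss p) = I"
    unfolding I_def by (rule polar_gauss_mean(1)[OF p]) measurable
  finally show ?thesis
    using fin by (simp add: add.commute[of _ I])
qed

lemma dot_le_nrm: "\<bar>dot p v x\<bar> \<le> nrm p v * nrm p x"
proof -
  have "\<bar>dot p v x\<bar> \<le> (\<Sum>i<p. \<bar>v i\<bar> * \<bar>x i\<bar>)"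
    unfolding dot_def by (rule order_trans[OF sum_abs]) (simp add: abs_mult)
  also have "\<dots> \<le> nrm p v * nrm p x"
    unfolding nrm_def by (rule L2_set_mult_ineq)
  finally show ?thesis .
qed

lemma dot_sq_le: "v \<in> usphere p \<Longrightarrow> y \<in> usphere p \<Longrightarrow> (dot p v y)\<^sup>2 \<le> 1"
  using dot_le_nrm[of p v y] by (simp add: usphere_eq abs_square_le_1)

text \<open>The exponent is scaled by \<open>p / 2\<close> because the comparison with the Gaussian
  divides it by \<open>p\<close>, the mean square length; what remains is the factor
  \<open>s / 2\<close> of \<open>gauss_mgf_pair\<close>.\<close>

lemma sphere_mgf_pair_le:
  assumes p: "0 < p" and vw: "v \<in> usphere p" "w \<in> usphere p"
    and s: "0 \<le> s" "s < 1" "s * \<bar>dot p v w\<bar> < 1 - s"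
  shows "(\<integral>\<^sup>+y. ennreal (exp (s * p / 2 * ((dot p v y)\<^sup>2 + (dot p w y)\<^sup>2))) \<partial>unif_sphere p)
    \<le> ennreal (1 / sqrt ((1 - s)\<^sup>2 - s\<^sup>2 * (dot p v w)\<^sup>2))"
proof -
  have cancel: "s * p / 2 * A / p = s * A / 2" for A
    using p by simp
  have "(\<integral>\<^sup>+y. ennreal (exp (s * p / 2 * ((dot p v y)\<^sup>2 + (dot p w y)\<^sup>2))) \<partial>unif_sphere p)
     \<le> (\<integral>\<^sup>+x. ennreal (exp (s * p / 2 * ((dot p v x)\<^sup>2 + (dot p w x)\<^sup>2) / p)) \<partial>gauss p)"
  proof (rule sphere_exp_le_gauss[OF p, where C = "s * p / 2 * (1 + 1)"])
    fix x assume "0 < nrm p x"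
    then show "s * p / 2 * ((dot p v x)\<^sup>2 + (dot p w x)\<^sup>2)
      = (nrm p x)\<^sup>2 * (s * p / 2 * ((dot p v (normalise p x))\<^sup>2 + (dot p w (normalise p x))\<^sup>2))"
      by (simp add: dot_normalise power_divide field_simps)
  next
    fix y assume "y \<in> usphere p"
    then have "(dot p v y)\<^sup>2 \<le> 1" "(dot p w y)\<^sup>2 \<le> 1" using dot_sq_le vw by auto
    then have "s * p / 2 * ((dot p v y)\<^sup>2 + (dot p w y)\<^sup>2) \<le> s * p / 2 * (1 + 1)"
      using s by (intro mult_left_mono add_mono) auto
    then show "0 \<le> s * p / 2 * ((dot p v y)\<^sup>2 + (dot p w y)\<^sup>2) \<and>
      s * p / 2 * ((dot p v y)\<^sup>2 + (dot p w y)\<^sup>2) \<le> s * p / 2 * (1 + 1)"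
      using s by auto
  qed measurable
  also have "\<dots> = (\<integral>\<^sup>+x. ennreal (exp (s * ((dot p v x)\<^sup>2 + (dot p w x)\<^sup>2) / 2)) \<partial>gauss p)"
    unfolding cancel ..
  also have "\<dots> = ennreal (1 / sqrt ((1 - s)\<^sup>2 - s\<^sup>2 * (dot p v w)\<^sup>2))"
    using vw s by (intro gauss_mgf_pair) (auto simp: usphere_eq)
  finally show ?thesis .
qed

lemma sphere_mgf_le:
  assumes p: "0 < p" and v: "v \<in> usphere p" and s: "0 \<le> s" "s < 1"
  shows "(\<integral>\<^sup>+y. ennreal (exp (s * p / 2 * (dot p v y)\<^sup>2)) \<partial>unif_sphere p) \<le> ennreal (1 / sqrt (1 - s))"
proof -
  have "(\<integral>\<^sup>+y. ennreal (exp (s * p / 2 * (dot p v y)\<^sup>2)) \<partial>unif_sphere p)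
     \<le> (\<integral>\<^sup>+x. ennreal (exp (s * p / 2 * (dot p v x)\<^sup>2 / p)) \<partial>gauss p)"
  proof (rule sphere_exp_le_gauss[OF p, where C = "s * p / 2 * 1"])
    fix x assume "0 < nrm p x"
    then show "s * p / 2 * (dot p v x)\<^sup>2 = (nrm p x)\<^sup>2 * (s * p / 2 * (dot p v (normalise p x))\<^sup>2)"
      by (simp add: dot_normalise power_divide field_simps)
  next
    fix y assume "y \<in> usphere p"
    then have "s * p / 2 * (dot p v y)\<^sup>2 \<le> s * p / 2 * 1"
      using s dot_sq_le[OF v] by (intro mult_left_mono) auto
    then show "0 \<le> s * p / 2 * (dot p v y)\<^sup>2 \<and> s * p / 2 * (dot p v y)\<^sup>2 \<le> s * p / 2 * 1"
      using s by auto
  qed measurable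
  also have "\<dots> = (\<integral>\<^sup>+x. ennreal (exp (s * (dot p v x)\<^sup>2 / 2)) \<partial>gauss p)"
    using p by (simp add: field_simps)
  also have "\<dots> = ennreal (1 / sqrt (1 - s))"
    using v s by (intro gauss_mgf) (auto simp: usphere_eq)
  finally show ?thesis .
qed

text \<open>The normalising integral of \<open>watson\<close>. Its bounds are obtained for each
  location separately, so the location stays an argument.\<close>

definition watson_norm :: "nat \<Rightarrow> real \<Rightarrow> (nat \<Rightarrow> real) \<Rightarrow> real" where
  "watson_norm p \<kappa> v = (\<integral>y. exp (\<kappa> * (dot p v y)\<^sup>2) \<partial>unif_sphere p)"

lemma watson_norm:
  assumes p: "0 < p" and v: "v \<in> usphere p" and \<kappa>: "0 \<le> \<kappa>"
  shows "(\<integral>\<^sup>+y. ennreal (exp (\<kappa> * (dot p v y)\<^sup>2)) \<partial>unif_sphere p) = ennreal (watson_norm p \<kappa> v)"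
    and "1 \<le> watson_norm p \<kappa> v"
proof -
  interpret U: prob_space "unif_sphere p" by (rule prob_space_unif_sphere[OF p])
  have m: "(\<lambda>y. exp (\<kappa> * (dot p v y)\<^sup>2)) \<in> borel_measurable (sphere_borel p)"
    by (rule measurable_sphere_Rn) measurable
  have "exp (\<kappa> * (dot p v y)\<^sup>2) \<le> exp \<kappa>" if "y \<in> usphere p" for y
    using dot_sq_le[OF v that] \<kappa> by (simp add: mult_left_le)
  then have int: "integrable (unif_sphere p) (\<lambda>y. exp (\<kappa> * (dot p v y)\<^sup>2))"
    using m by (intro U.integrable_const_bound[where B = "exp \<kappa>"] AE_I2) auto
  then show "(\<integral>\<^sup>+y. ennreal (exp (\<kappa> * (dot p v y)\<^sup>2)) \<partial>unif_sphere p) = ennreal (watson_norm p \<kappa> v)"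
    unfolding watson_norm_def by (rule nn_integral_eq_integral) simp
  have "(\<integral>y. 1 \<partial>unif_sphere p) \<le> watson_norm p \<kappa> v"
    unfolding watson_norm_def using int \<kappa> by (intro integral_mono) auto
  then show "1 \<le> watson_norm p \<kappa> v" using U.prob_space by simp
qed

text \<open>
  The loss must be of order \<open>t\<^sup>2 / p\<close>, since it is raised to the power \<open>n\<close> and only \<open>n t\<^sup>2 / p\<close> is bounded.
  Bounding \<open>exp (\<kappa> (g \<bullet> v)\<^sup>2 / |g|\<^sup>2)\<close> directly by a tangent loses \<open>t / p\<close>; the harmless weight
  \<open>|g|\<^sup>2 / p\<close>, of mean 1 and independent of the direction, cancels this first-order term.
\<close>

lemma watson_norm_ge:
  assumes p: "0 < p" and v: "v \<in> usphere p" and s: "0 \<le> s" "s < 1"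
  defines "t \<equiv> s / (1 - s)"
  shows "exp (- 3 * t\<^sup>2 / (2 * p)) / sqrt (1 - s) \<le> watson_norm p (s * p / 2) v"
proof -
  define Z where "Z = watson_norm p (s * p / 2) v"
  \<comment> \<open>The tangent to exp is taken at \<open>U + c\<close>. After integration the bound
    carries the factor \<open>1 - 3 t^2 / (2 p) - c - c t / p\<close>; this \<open>c\<close> cancels
    the two middle terms, and the rest is at least 1 because \<open>c \<le> 0\<close>.\<close>
  define c where "c = - 3 * t\<^sup>2 / (2 * p)"
  define S where "S = 1 / sqrt (1 - s)"
  have nv: "nrm p v = 1" using v by (simp add: usphere_eq)
  have c: "c \<le> 0" by (simp add: c_def)
  have t: "0 \<le> t" "1 / (1 - s) = 1 + t" using s by (auto simp: t_def field_simps)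
  have S: "0 \<le> S" using s by (simp add: S_def)
  have Z0: "0 \<le> Z" using watson_norm(2)[OF p v, of "s * p / 2"] s by (simp add: Z_def)
  \<comment> \<open>In terms of the exponent \<open>U\<close> these are \<open>exp U\<close> and
    \<open>(1 + 2 * U) * exp U\<close>, so \<open>U * exp U = (F - E) / 2\<close>. Their integrals,
    with and without the weight |x|^2, are the four formulas above.\<close>
  define E where "E x = exp (s * (dot p v x)\<^sup>2 / 2)" for x
  define F where "F x = (1 + s * (dot p v x)\<^sup>2) * exp (s * (dot p v x)\<^sup>2 / 2)" for x
  have E0: "0 \<le> E x" and F0: "0 \<le> F x" for x using s by (auto simp: E_def F_def)
  have [measurable]: "E \<in> borel_measurable (Rn p)" "F \<in> borel_measurable (Rn p)"
    unfolding E_def F_def by measurable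
  have pw: "exp c * ((3 / 2 - c) / p * (E x * (nrm p x)\<^sup>2) + 1 / 2 * F x)
     \<le> exp (s * p / 2 * (dot p v (normalise p x))\<^sup>2) * ((nrm p x)\<^sup>2 / p)
        + exp c * (1 / (2 * p) * (F x * (nrm p x)\<^sup>2) + 1 / 2 * E x)"
    if x: "0 < nrm p x" for x
  proof -
    define R where "R = (nrm p x)\<^sup>2"
    define U where "U = s * (dot p v x)\<^sup>2 / 2"
    have R: "0 < R" using x by (simp add: R_def)
    have Ex: "E x = exp U" and Fx: "F x = (1 + 2 * U) * exp U"
      by (simp_all add: E_def F_def U_def)
    have ex: "s * p / 2 * (dot p v (normalise p x))\<^sup>2 = U * p / R"
      by (simp add: dot_normalise power_divide U_def R_def)
    \<comment> \<open>The tangent inequality with the weight \<open>R / p\<close> attached. The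
      weight turns \<open>U * p / R\<close> into plain \<open>U\<close>, so no inverse power of the
      length is left to integrate.\<close>
    have "exp (c + U) * (R / p) * (1 + (U * p / R - U - c)) \<le> exp (c + U) * (R / p) * exp (U * p / R - U - c)"
      using R by (intro mult_left_mono exp_ge_add_one_self) auto
    also have "\<dots> = exp (U * p / R) * (R / p)"
      by (simp add: exp_add[symmetric] mult.commute mult.left_commute)
    finally have "exp (c + U) * (R / p) * (1 + (U * p / R - U - c)) \<le> exp (U * p / R) * (R / p)" .
    moreover have "exp (c + U) * (R / p) * (1 + (U * p / R - U - c)) = exp c * exp U * ((1 - c - U) * R / p + U)"
      using R p by (simp add: exp_add field_simps)
    moreover have "exp c * ((3 / 2 - c) / p * (exp U * R) + 1 / 2 * ((1 + 2 * U) * exp U))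
       - exp c * (1 / (2 * p) * (((1 + 2 * U) * exp U) * R) + 1 / 2 * exp U) = exp c * exp U * ((1 - c - U) * R / p + U)"
      using p by (simp add: field_simps)
    ultimately show ?thesis
      unfolding ex R_def[symmetric] Ex Fx by linarith
  qed
  have mf: "(\<lambda>y. ennreal (exp (s * p / 2 * (dot p v y)\<^sup>2))) \<in> borel_measurable (Rn p)"
    by measurable
  have i1: "(\<integral>\<^sup>+x. ennreal (E x * (nrm p x)\<^sup>2) \<partial>gauss p) = ennreal ((p + t) * S)"
    using gauss_mgf_nrm[OF nv s] by (simp add: E_def ennreal_mult t_def S_def)
  have i2: "(\<integral>\<^sup>+x. ennreal (F x) \<partial>gauss p) = ennreal ((1 + t) * S)"
    using gauss_mgf_sq[OF nv s] by (simp add: F_def S_def t(2)[symmetric])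
  have i3: "(\<integral>\<^sup>+x. ennreal (E x) \<partial>gauss p) = ennreal S"
    using gauss_mgf[OF nv s] by (simp add: E_def S_def)
  have tt: "real p / (1 - s) + 3 * s / (1 - s)\<^sup>2 = (1 + t) * (p + 3 * t)"
    unfolding t(2)[symmetric] by (simp add: t_def power2_eq_square add_divide_distrib)
  have i4: "(\<integral>\<^sup>+x. ennreal (F x * (nrm p x)\<^sup>2) \<partial>gauss p) = ennreal ((1 + t) * (p + 3 * t) * S)"
  proof -
    have "ennreal (F x * (nrm p x)\<^sup>2) = ennreal (F x) * ennreal ((nrm p x)\<^sup>2)" for x
      using F0 by (simp add: ennreal_mult)
    then show ?thesis
      using gauss_mgf_sq_nrm[OF nv s] unfolding tt by (simp add: F_def S_def)
  qed
  define X where "X = exp c * ((3 / 2 - c) / p * ((p + t) * S) + 1 / 2 * ((1 + t) * S))"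
  define Y where "Y = exp c * (1 / (2 * p) * ((1 + t) * (p + 3 * t) * S) + 1 / 2 * S)"
  have Y0: "0 \<le> Y" using t S by (auto simp: Y_def intro!: mult_nonneg_nonneg add_nonneg_nonneg)
  have lin: "(\<integral>\<^sup>+x. ennreal (exp c * (a * f x + b * g x)) \<partial>gauss p) = ennreal (exp c * (a * A + b * B))"
    if "(\<integral>\<^sup>+x. ennreal (f x) \<partial>gauss p) = ennreal A" "(\<integral>\<^sup>+x. ennreal (g x) \<partial>gauss p) = ennreal B"
      "f \<in> borel_measurable (Rn p)" "g \<in> borel_measurable (Rn p)"
      "\<And>x. 0 \<le> f x" "\<And>x. 0 \<le> g x" "0 \<le> a" "0 \<le> b" "0 \<le> A" "0 \<le> B" for f g a b A B
  proof -
    note [measurable] = that(3,4)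
    have "ennreal (exp c * (a * f x + b * g x)) = ennreal (exp c) * (ennreal a * ennreal (f x) + ennreal b * ennreal (g x))" for x
      using that by (simp add: ennreal_mult[symmetric] ennreal_plus[symmetric] del: ennreal_plus)
    then have "(\<integral>\<^sup>+x. ennreal (exp c * (a * f x + b * g x)) \<partial>gauss p)
      = ennreal (exp c) * (ennreal a * (\<integral>\<^sup>+x. ennreal (f x) \<partial>gauss p) + ennreal b * (\<integral>\<^sup>+x. ennreal (g x) \<partial>gauss p))"
      by (simp add: nn_integral_add nn_integral_cmult del: ennreal_plus)
    also have "\<dots> = ennreal (exp c * (a * A + b * B))"
      unfolding that(1,2) using that by (simp add: ennreal_mult[symmetric] ennreal_plus[symmetric] del: ennreal_plus)
    finally show ?thesis .
  qed
  have "ennreal X = (\<integral>\<^sup>+x. ennreal (exp c * ((3 / 2 - c) / p * (E x * (nrm p x)\<^sup>2) + 1 / 2 * F x)) \<partial>gauss p)"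
    unfolding X_def by (rule lin[OF i1 i2, symmetric]) (use E0 F0 c t S in auto)
  also have "\<dots> \<le> (\<integral>\<^sup>+x. ennreal (exp (s * p / 2 * (dot p v (normalise p x))\<^sup>2)) * ennreal ((nrm p x)\<^sup>2 / p)
      + ennreal (exp c * (1 / (2 * p) * (F x * (nrm p x)\<^sup>2) + 1 / 2 * E x)) \<partial>gauss p)"
  proof (rule nn_integral_mono_AE)
    show "AE x in gauss p. ennreal (exp c * ((3 / 2 - c) / p * (E x * (nrm p x)\<^sup>2) + 1 / 2 * F x))
      \<le> ennreal (exp (s * p / 2 * (dot p v (normalise p x))\<^sup>2)) * ennreal ((nrm p x)\<^sup>2 / p)
      + ennreal (exp c * (1 / (2 * p) * (F x * (nrm p x)\<^sup>2) + 1 / 2 * E x))"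
      using AE_gauss_nrm_pos[OF p]
    proof eventually_elim
      case (elim x)
      have nn: "0 \<le> exp c * (1 / (2 * p) * (F x * (nrm p x)\<^sup>2) + 1 / 2 * E x)"
        using E0[of x] F0[of x] by auto
      have comb: "ennreal a * ennreal b + ennreal d = ennreal (a * b + d)"
        if "0 \<le> a" "0 \<le> b" "0 \<le> d" for a b d
        using that by (simp add: ennreal_mult)
      have "0 \<le> (nrm p x)\<^sup>2 / p" by simp
      from comb[OF exp_ge_zero this nn] show ?case
        using ennreal_leI[OF pw[OF elim]] by (simp only:)
    qed
  qed
  also have "\<dots> = (\<integral>\<^sup>+x. ennreal (exp (s * p / 2 * (dot p v (normalise p x))\<^sup>2)) * ennreal ((nrm p x)\<^sup>2 / p) \<partial>gauss p)
      + (\<integral>\<^sup>+x. ennreal (exp c * (1 / (2 * p) * (F x * (nrm p x)\<^sup>2) + 1 / 2 * E x)) \<partial>gauss p)"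
    by (rule nn_integral_add) auto
  also have "(\<integral>\<^sup>+x. ennreal (exp (s * p / 2 * (dot p v (normalise p x))\<^sup>2)) * ennreal ((nrm p x)\<^sup>2 / p) \<partial>gauss p) = ennreal Z"
    unfolding polar_gauss_mean(2)[OF p mf] Z_def using s by (intro watson_norm(1)[OF p v]) auto
  also have "(\<integral>\<^sup>+x. ennreal (exp c * (1 / (2 * p) * (F x * (nrm p x)\<^sup>2) + 1 / 2 * E x)) \<partial>gauss p) = ennreal Y"
    unfolding Y_def by (rule lin[OF i4 i3]) (use E0 F0 c t S in auto)
  finally have "X \<le> Z + Y"
    using Z0 Y0 by (simp add: ennreal_plus[symmetric] del: ennreal_plus)
  moreover have "X - Y = exp c * S * (1 - c * t / p)"
  proof -
    have "X - Y = exp c * S * ((3 / 2 - c) * (1 + t / p) + (1 + t) / 2 - (1 + t) * (1 + 3 * t / p) / 2 - 1 / 2)"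
      using p by (simp add: X_def Y_def field_simps)
    also have "(3 / 2 - c) * (1 + t / p) + (1 + t) / 2 - (1 + t) * (1 + 3 * t / p) / 2 - 1 / 2
       = 1 - 3 * t\<^sup>2 / (2 * p) - c - c * t / p"
      using p by (simp add: field_simps power2_eq_square)
    also have "\<dots> = 1 - c * t / p" by (simp add: c_def)
    finally show ?thesis .
  qed
  moreover have "exp c * S * 1 \<le> exp c * S * (1 - c * t / p)"
    using c t S by (intro mult_left_mono) (auto simp: mult_nonpos_nonneg divide_nonpos_nonneg)
  ultimately show ?thesis unfolding Z_def[symmetric] by (simp add: c_def S_def)
qed

subsection \<open>Mixtures and product likelihoods\<close>

lemma prob_space_densityI:
  "f \<in> borel_measurable M \<Longrightarrow> (\<integral>\<^sup>+x. f x \<partial>M) = 1 \<Longrightarrow> prob_space (density M f)"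
  by (intro prob_spaceI) (simp add: emeasure_density cong: nn_integral_cong)

lemma PiM_density:
  fixes f :: "'a \<Rightarrow> ennreal"
  assumes I: "finite I" and M: "prob_space M" and f [measurable]: "f \<in> borel_measurable M"
    and D: "prob_space (density M f)"
  shows "(\<Pi>\<^sub>M i\<in>I. density M f) = density (\<Pi>\<^sub>M i\<in>I. M) (\<lambda>X. \<Prod>i\<in>I. f (X i))"
proof -
  interpret D: prob_space "density M f" by (rule D)
  interpret M: prob_space M by (rule M)
  interpret DP: product_sigma_finite "\<lambda>_. density M f" ..
  interpret MP: product_sigma_finite "\<lambda>_. M" ..
  have m [measurable]: "(\<lambda>X. \<Prod>i\<in>I. f (X i)) \<in> borel_measurable (\<Pi>\<^sub>M i\<in>I. M)"
    by measurable
  have "density (\<Pi>\<^sub>M i\<in>I. M) (\<lambda>X. \<Prod>i\<in>I. f (X i)) = (\<Pi>\<^sub>M i\<in>I. density M f)"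
  proof (rule DP.PiM_eqI[OF I])
    show "sets (density (\<Pi>\<^sub>M i\<in>I. M) (\<lambda>X. \<Prod>i\<in>I. f (X i))) = sets (\<Pi>\<^sub>M i\<in>I. density M f)"
      by (simp, rule sets_PiM_cong) auto
    fix A :: "'b \<Rightarrow> 'a set"
    assume "\<And>i. i \<in> I \<Longrightarrow> A i \<in> sets (density M f)"
    then have A [measurable]: "A i \<in> sets M" if "i \<in> I" for i using that by simp
    have PA: "Pi\<^sub>E I A \<in> sets (\<Pi>\<^sub>M i\<in>I. M)"
      using A I by (intro sets_PiM_I_finite) auto
    have "emeasure (density (\<Pi>\<^sub>M i\<in>I. M) (\<lambda>X. \<Prod>i\<in>I. f (X i))) (Pi\<^sub>E I A)
      = (\<integral>\<^sup>+X. (\<Prod>i\<in>I. f (X i)) * indicator (Pi\<^sub>E I A) X \<partial>(\<Pi>\<^sub>M i\<in>I. M))"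
      using PA by (simp add: emeasure_density)
    also have "\<dots> = (\<integral>\<^sup>+X. (\<Prod>i\<in>I. f (X i) * indicator (A i) (X i)) \<partial>(\<Pi>\<^sub>M i\<in>I. M))"
    proof (rule nn_integral_cong)
      fix X assume X: "X \<in> space (\<Pi>\<^sub>M i\<in>I. M)"
      have "indicator (Pi\<^sub>E I A) X = (\<Prod>i\<in>I. indicator (A i) (X i) :: ennreal)"
      proof (cases "X \<in> Pi\<^sub>E I A")
        case False
        then obtain i where "i \<in> I" "X i \<notin> A i"
          using X by (auto simp: space_PiM PiE_iff)
        then show ?thesis using False I by (auto simp: prod_zero_iff intro!: bexI[of _ i])
      qed (auto simp: PiE_iff)
      then show "(\<Prod>i\<in>I. f (X i)) * indicator (Pi\<^sub>E I A) X = (\<Prod>i\<in>I. f (X i) * indicator (A i) (X i))"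
        by (simp add: prod.distrib)
    qed
    also have "\<dots> = (\<Prod>i\<in>I. \<integral>\<^sup>+x. f x * indicator (A i) x \<partial>M)"
      using A I by (intro MP.product_nn_integral_prod) auto
    also have "\<dots> = (\<Prod>i\<in>I. emeasure (density M f) (A i))"
      using A by (intro prod.cong) (auto simp: emeasure_density)
    finally show "emeasure (density (\<Pi>\<^sub>M i\<in>I. M) (\<lambda>X. \<Prod>i\<in>I. f (X i))) (Pi\<^sub>E I A)
      = (\<Prod>i\<in>I. emeasure (density M f) (A i))" .
  qed
  then show ?thesis by simp
qed

text \<open>The error of the first kind plus the average error of the second kind dominates the mean
  of the smaller of 1 and the averaged truncated likelihood ratio \<open>g\<close>. On
  \<open>B\<close> one uses \<open>g \<le> 1 + g^2 / 4\<close>; off \<open>B\<close>,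
  \<open>g\<close> is at most the average of the untruncated densities. The hypotheses give mean at
  least 3/4 and second moment at most 2, and some \<open>v\<close> does at least as badly as the
  average.\<close>

lemma mixture_second_moment_bound:
  fixes \<Theta> :: "'v set" and l :: "'v \<Rightarrow> 'a \<Rightarrow> real"
  assumes "prob_space M" and \<Theta>: "finite \<Theta>" "\<Theta> \<noteq> {}"
    and lm [measurable]: "\<And>v. v \<in> \<Theta> \<Longrightarrow> l v \<in> borel_measurable M"
    and l0: "\<And>v x. v \<in> \<Theta> \<Longrightarrow> 0 \<le> l v x"
    and l1: "\<And>v. v \<in> \<Theta> \<Longrightarrow> (\<integral>\<^sup>+x. ennreal (l v x) \<partial>M) = 1"
    and Am [measurable]: "\<And>v. v \<in> \<Theta> \<Longrightarrow> A v \<in> sets M"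
    and lA: "\<And>v. v \<in> \<Theta> \<Longrightarrow> (\<integral>\<^sup>+x. ennreal (l v x * indicator (space M - A v) x) \<partial>M) \<le> ennreal (1 / 4)"
    and l2: "\<And>v. v \<in> \<Theta> \<Longrightarrow> (\<Sum>w\<in>\<Theta>. \<integral>\<^sup>+x. ennreal (l v x * indicator (A v) x * (l w x * indicator (A w) x)) \<partial>M)
      \<le> ennreal (2 * real (card \<Theta>))"
    and B [measurable]: "B \<in> sets M"
  obtains v where "v \<in> \<Theta>" "1 / 4 \<le> measure M B + measure (density M (\<lambda>x. ennreal (l v x))) (space M - B)"
proof -
  interpret prob_space M by fact
  define N where "N = real (card \<Theta>)"
  have N: "0 < N" using \<Theta> by (simp add: N_def card_gt_0_iff)
  define h where "h v x = l v x * indicator (A v) x" for v x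
  have h0: "0 \<le> h v x" if "v \<in> \<Theta>" for v x using that l0 by (simp add: h_def)
  have hl: "h v x \<le> l v x" if "v \<in> \<Theta>" for v x using that l0 by (simp add: h_def indicator_def)
  have hm [measurable]: "h v \<in> borel_measurable M" if "v \<in> \<Theta>" for v
    unfolding h_def using that by measurable
  define g where "g x = (\<Sum>v\<in>\<Theta>. h v x) / N" for x
  have g0: "0 \<le> g x" for x using h0 N by (simp add: g_def sum_nonneg)
  have gm [measurable]: "g \<in> borel_measurable M" unfolding g_def by measurable
  define b where "b v = measure (density M (\<lambda>x. ennreal (l v x))) (space M - B)" for v
  have Qv: "ennreal (b v) = (\<integral>\<^sup>+x. ennreal (l v x) * indicator (space M - B) x \<partial>M)" if v: "v \<in> \<Theta>" for v
  proof -
    interpret D: prob_space "density M (\<lambda>x. ennreal (l v x))"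
      using l1[OF v] lm[OF v] by (intro prob_space_densityI) auto
    show ?thesis unfolding b_def D.emeasure_eq_measure[symmetric]
      using lm[OF v] by (subst emeasure_density) auto
  qed
  have gE: "ennreal (g x) = ennreal (1 / N) * (\<Sum>v\<in>\<Theta>. ennreal (h v x))" for x
    using h0 N by (simp add: g_def sum_ennreal sum_nonneg ennreal_mult[symmetric])
  have int_h: "ennreal (3 / 4) \<le> (\<integral>\<^sup>+x. ennreal (h v x) \<partial>M)" if v: "v \<in> \<Theta>" for v
  proof -
    have "1 = (\<integral>\<^sup>+x. ennreal (l v x) \<partial>M)" using l1[OF v] by simp
    also have "\<dots> = (\<integral>\<^sup>+x. ennreal (h v x) + ennreal (l v x * indicator (space M - A v) x) \<partial>M)"
      by (intro nn_integral_cong) (auto simp: h_def indicator_def)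
    also have "\<dots> = (\<integral>\<^sup>+x. ennreal (h v x) \<partial>M) + (\<integral>\<^sup>+x. ennreal (l v x * indicator (space M - A v) x) \<partial>M)"
      using v by (intro nn_integral_add) auto
    also have "\<dots> \<le> (\<integral>\<^sup>+x. ennreal (h v x) \<partial>M) + ennreal (1 / 4)"
      using lA[OF v] by (rule add_left_mono)
    finally have le: "1 \<le> (\<integral>\<^sup>+x. ennreal (h v x) \<partial>M) + ennreal (1 / 4)" .
    show ?thesis
    proof (cases "\<integral>\<^sup>+x. ennreal (h v x) \<partial>M")
      case (real r)
      have "ennreal 1 \<le> ennreal (r + 1 / 4)"
        using le real by (simp add: ennreal_plus del: ennreal_plus[symmetric])
      then have "3 / 4 \<le> r" using real by (subst (asm) ennreal_le_iff) auto
      then show ?thesis unfolding real(2) by (rule ennreal_leI)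
    qed simp
  qed
  have int_g: "ennreal (3 / 4) \<le> (\<integral>\<^sup>+x. ennreal (g x) \<partial>M)"
  proof -
    have "(\<Sum>v\<in>\<Theta>. ennreal (3 / 4)) = ennreal (\<Sum>v\<in>\<Theta>. 3 / 4)"
      by (rule sum_ennreal) simp
    then have "ennreal (3 / 4) = ennreal (1 / N) * (\<Sum>v\<in>\<Theta>. ennreal (3 / 4))"
      using N by (simp add: ennreal_mult[symmetric] N_def del: sum_constant) (simp add: ennreal_mult[symmetric])
    also have "\<dots> \<le> ennreal (1 / N) * (\<Sum>v\<in>\<Theta>. \<integral>\<^sup>+x. ennreal (h v x) \<partial>M)"
      using int_h by (intro mult_left_mono sum_mono) auto
    also have "\<dots> = (\<integral>\<^sup>+x. ennreal (g x) \<partial>M)"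
      unfolding gE by (simp add: nn_integral_cmult nn_integral_sum)
    finally show ?thesis .
  qed
  have int_g2: "(\<integral>\<^sup>+x. ennreal ((g x)\<^sup>2 / 4) \<partial>M) \<le> ennreal (1 / 2)"
  proof -
    have "ennreal ((g x)\<^sup>2 / 4) = ennreal (1 / (4 * N\<^sup>2)) * (\<Sum>v\<in>\<Theta>. \<Sum>w\<in>\<Theta>. ennreal (h v x * h w x))" for x
    proof -
      have "(g x)\<^sup>2 / 4 = 1 / (4 * N\<^sup>2) * (\<Sum>v\<in>\<Theta>. \<Sum>w\<in>\<Theta>. h v x * h w x)"
        by (simp add: g_def power2_eq_square sum_product[symmetric])
      then show ?thesis
        using h0 N by (simp add: sum_ennreal sum_nonneg ennreal_mult[symmetric])
    qed
    then have "(\<integral>\<^sup>+x. ennreal ((g x)\<^sup>2 / 4) \<partial>M)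
      = ennreal (1 / (4 * N\<^sup>2)) * (\<Sum>v\<in>\<Theta>. \<Sum>w\<in>\<Theta>. \<integral>\<^sup>+x. ennreal (h v x * h w x) \<partial>M)"
      by (simp add: nn_integral_cmult nn_integral_sum)
    also have "\<dots> \<le> ennreal (1 / (4 * N\<^sup>2)) * (\<Sum>v\<in>\<Theta>. ennreal (2 * N))"
      using l2 by (intro mult_left_mono sum_mono) (auto simp: h_def N_def)
    also have "(\<Sum>v\<in>\<Theta>. ennreal (2 * N)) = ennreal (\<Sum>v\<in>\<Theta>. 2 * N)"
      using N by (intro sum_ennreal) simp
    also have "(\<Sum>v\<in>\<Theta>. 2 * N) = 2 * N\<^sup>2"
      by (simp add: N_def power2_eq_square)
    also have "ennreal (1 / (4 * N\<^sup>2)) * ennreal (2 * N\<^sup>2) = ennreal (1 / (4 * N\<^sup>2) * (2 * N\<^sup>2))"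
      by (rule ennreal_mult[symmetric]) auto
    also have "1 / (4 * N\<^sup>2) * (2 * N\<^sup>2) = 1 / 2"
      using N by simp
    finally show ?thesis .
  qed
  have avg: "ennreal ((\<Sum>v\<in>\<Theta>. b v) / N) = ennreal (1 / N) * (\<Sum>v\<in>\<Theta>. \<integral>\<^sup>+x. ennreal (l v x) * indicator (space M - B) x \<partial>M)"
  proof -
    have "(\<Sum>v\<in>\<Theta>. \<integral>\<^sup>+x. ennreal (l v x) * indicator (space M - B) x \<partial>M) = (\<Sum>v\<in>\<Theta>. ennreal (b v))"
      using Qv by simp
    also have "\<dots> = ennreal (\<Sum>v\<in>\<Theta>. b v)" by (rule sum_ennreal) (simp add: b_def)
    finally show ?thesis using N by (simp add: ennreal_mult[symmetric] sum_nonneg b_def)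
  qed
  have pw: "ennreal (g x) \<le> indicator B x + ennreal (1 / N) * (\<Sum>v\<in>\<Theta>. ennreal (l v x) * indicator (space M - B) x)
      + ennreal ((g x)\<^sup>2 / 4)" if x: "x \<in> space M" for x
  proof (cases "x \<in> B")
    case True
    \<comment> \<open>This square expands to the bound \<open>g x \<le> 1 + (g x)^2 / 4\<close>,
      with equality at \<open>g x = 2\<close>.\<close>
    have "0 \<le> (1 - g x / 2)\<^sup>2" by simp
    then have "g x \<le> 1 + (g x)\<^sup>2 / 4" by (simp add: power2_eq_square field_simps)
    then have "ennreal (g x) \<le> ennreal (1 + (g x)\<^sup>2 / 4)" by (rule ennreal_leI)
    also have "\<dots> = 1 + ennreal ((g x)\<^sup>2 / 4)" by (subst ennreal_plus) auto
    finally show ?thesis using True by simp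
  next
    case False
    have "ennreal (g x) \<le> ennreal (1 / N) * (\<Sum>v\<in>\<Theta>. ennreal (l v x) * indicator (space M - B) x)"
      unfolding gE using False x hl by (intro mult_left_mono sum_mono) (auto intro: ennreal_leI)
    then show ?thesis using False by (auto intro: order_trans simp: add_increasing2)
  qed
  have "ennreal (3 / 4) \<le> (\<integral>\<^sup>+x. ennreal (g x) \<partial>M)" by (rule int_g)
  also have "\<dots> \<le> (\<integral>\<^sup>+x. indicator B x + ennreal (1 / N) * (\<Sum>v\<in>\<Theta>. ennreal (l v x) * indicator (space M - B) x)
      + ennreal ((g x)\<^sup>2 / 4) \<partial>M)"
    by (rule nn_integral_mono) (rule pw)
  also have "\<dots> = emeasure M B + ennreal ((\<Sum>v\<in>\<Theta>. b v) / N) + (\<integral>\<^sup>+x. ennreal ((g x)\<^sup>2 / 4) \<partial>M)"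
    unfolding avg by (simp add: nn_integral_add nn_integral_cmult nn_integral_sum)
  also have "\<dots> \<le> ennreal (measure M B) + ennreal ((\<Sum>v\<in>\<Theta>. b v) / N) + ennreal (1 / 2)"
    using int_g2 by (intro add_mono) (auto simp: emeasure_eq_measure)
  also have "\<dots> = ennreal (measure M B + (\<Sum>v\<in>\<Theta>. b v) / N + 1 / 2)"
    using N by (simp add: ennreal_plus sum_nonneg b_def del: ennreal_plus[symmetric])
  finally have main: "1 / 4 \<le> measure M B + (\<Sum>v\<in>\<Theta>. b v) / N"
    using N by (subst (asm) ennreal_le_iff) (auto intro!: add_nonneg_nonneg divide_nonneg_pos sum_nonneg simp: b_def)
  have "\<exists>v\<in>\<Theta>. (\<Sum>v\<in>\<Theta>. b v) / N \<le> b v"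
  proof (rule ccontr)
    assume "\<not> ?thesis"
    then have "(\<Sum>v\<in>\<Theta>. b v) < (\<Sum>v\<in>\<Theta>. (\<Sum>v\<in>\<Theta>. b v) / N)"
      using \<Theta> by (intro sum_strict_mono) auto
    then show False using N by (simp add: N_def[symmetric])
  qed
  then obtain v where "v \<in> \<Theta>" "(\<Sum>v\<in>\<Theta>. b v) / N \<le> b v" by blast
  then have "1 / 4 \<le> measure M B + b v" using main by linarith
  then show ?thesis using \<open>v \<in> \<Theta>\<close> by (intro that[of v]) (simp_all only: b_def)
qed

section \<open>Samples, the projection statistic and the likelihood ratio\<close>

definition sample :: "nat \<Rightarrow> nat \<Rightarrow> (nat \<Rightarrow> nat \<Rightarrow> real) measure" where
  "sample p n = (\<Pi>\<^sub>M j\<in>{..<n}. unif_sphere p)"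

definition tstat :: "nat \<Rightarrow> nat \<Rightarrow> (nat \<Rightarrow> real) \<Rightarrow> (nat \<Rightarrow> nat \<Rightarrow> real) \<Rightarrow> real" where
  "tstat p n v X = (\<Sum>j<n. (dot p v (X j))\<^sup>2)"

text \<open>The density of the Watson sample with respect to the uniform sample. It depends on the
  data through \<open>tstat\<close> only, and for positive \<kappa> increasingly so, which is why
  truncating \<open>tstat\<close> controls its moments.\<close>

definition lik :: "nat \<Rightarrow> nat \<Rightarrow> real \<Rightarrow> (nat \<Rightarrow> real) \<Rightarrow> (nat \<Rightarrow> nat \<Rightarrow> real) \<Rightarrow> real" where
  "lik p n \<kappa> v X = exp (\<kappa> * tstat p n v X) / watson_norm p \<kappa> v ^ n"

lemma measurable_sample_compose:
  "j < n \<Longrightarrow> f \<in> borel_measurable (Rn p) \<Longrightarrow> (\<lambda>X. f (X j)) \<in> borel_measurable (sample p n)"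
proof -
  assume j: "j < n" and f: "f \<in> borel_measurable (Rn p)"
  have "(\<lambda>X. X j) \<in> sample p n \<rightarrow>\<^sub>M unif_sphere p"
    unfolding sample_def using j by (intro measurable_component_singleton) auto
  moreover have "f \<in> borel_measurable (unif_sphere p)"
    using measurable_sphere_Rn[OF f] by simp
  ultimately show ?thesis by (rule measurable_compose)
qed

lemma measurable_tstat [measurable]: "tstat p n v \<in> borel_measurable (sample p n)"
  unfolding tstat_def by (intro borel_measurable_sum measurable_sample_compose) auto

lemma measurable_lik [measurable]: "lik p n \<kappa> v \<in> borel_measurable (sample p n)"
  unfolding lik_def by measurable

lemma prob_space_sample: "0 < p \<Longrightarrow> prob_space (sample p n)"
  unfolding sample_def by (intro prob_space_PiM prob_space_unif_sphere)

lemma sample_exp: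
  assumes p: "0 < p" and q: "q \<in> borel_measurable (Rn p)"
  shows "(\<integral>\<^sup>+X. ennreal (exp (\<Sum>j<n. q (X j))) \<partial>sample p n) = (\<integral>\<^sup>+y. ennreal (exp (q y)) \<partial>unif_sphere p) ^ n"
proof -
  interpret U: prob_space "unif_sphere p" by (rule prob_space_unif_sphere[OF p])
  interpret product_sigma_finite "\<lambda>_::nat. unif_sphere p" ..
  have [measurable]: "q \<in> borel_measurable (sphere_borel p)" by (rule measurable_sphere_Rn[OF q])
  have "(\<integral>\<^sup>+X. ennreal (exp (\<Sum>j<n. q (X j))) \<partial>sample p n) = (\<integral>\<^sup>+X. (\<Prod>j<n. ennreal (exp (q (X j)))) \<partial>sample p n)"
    by (simp add: exp_sum prod_ennreal)
  also have "\<dots> = (\<Prod>j<n. \<integral>\<^sup>+y. ennreal (exp (q y)) \<partial>unif_sphere p)"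
    unfolding sample_def by (rule product_nn_integral_prod) auto
  finally show ?thesis by simp
qed

lemma prod_watson:
  assumes p: "0 < p" and v: "v \<in> usphere p" and \<kappa>: "0 \<le> \<kappa>"
  shows "(\<Pi>\<^sub>M j\<in>{..<n}. watson p \<kappa> v) = density (sample p n) (\<lambda>X. ennreal (lik p n \<kappa> v X))"
    and "(\<integral>\<^sup>+X. ennreal (lik p n \<kappa> v X) \<partial>sample p n) = 1"
proof -
  define W where "W = watson_norm p \<kappa> v"
  have W: "1 \<le> W" "(\<integral>\<^sup>+y. ennreal (exp (\<kappa> * (dot p v y)\<^sup>2)) \<partial>unif_sphere p) = ennreal W"
    using watson_norm[OF p v \<kappa>] by (simp_all add: W_def)
  define f where "f x = ennreal (exp (\<kappa> * (dot p v x)\<^sup>2) / W)" for x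
  have f [measurable]: "f \<in> borel_measurable (sphere_borel p)"
    unfolding f_def by (rule measurable_sphere_Rn) measurable
  have "(\<Sum>i<p. x i * v i) = dot p v x" for x
    by (simp add: dot_def mult.commute)
  then have wat: "watson p \<kappa> v = density (unif_sphere p) f"
    unfolding watson_def f_def W_def watson_norm_def by simp
  have fE: "f x = ennreal (1 / W) * ennreal (exp (\<kappa> * (dot p v x)\<^sup>2))" for x
    using W(1) by (simp add: f_def ennreal_mult[symmetric])
  have m: "(\<lambda>x. ennreal (exp (\<kappa> * (dot p v x)\<^sup>2))) \<in> borel_measurable (sphere_borel p)"
    by (rule measurable_sphere_Rn) measurable
  have int: "(\<integral>\<^sup>+x. f x \<partial>unif_sphere p) = 1"
  proof -
    have "(\<integral>\<^sup>+x. f x \<partial>unif_sphere p) = ennreal (1 / W) * ennreal W"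
      unfolding fE using m by (simp add: nn_integral_cmult W(2))
    then show ?thesis using W(1) by (simp add: ennreal_mult[symmetric])
  qed
  have D: "prob_space (density (unif_sphere p) f)"
    using int by (intro prob_space_densityI) auto
  have lik: "ennreal (lik p n \<kappa> v X) = (\<Prod>j<n. f (X j))" for X
    unfolding f_def lik_def W_def[symmetric] tstat_def sum_distrib_left exp_sum[OF finite_lessThan]
    using W(1) by (simp add: prod_ennreal prod_dividef)
  show *: "(\<Pi>\<^sub>M j\<in>{..<n}. watson p \<kappa> v) = density (sample p n) (\<lambda>X. ennreal (lik p n \<kappa> v X))"
    unfolding wat sample_def lik
    by (rule PiM_density[OF _ prob_space_unif_sphere[OF p] _ D]) auto
  have "prob_space (\<Pi>\<^sub>M j\<in>{..<n}. watson p \<kappa> v)"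
    unfolding wat by (rule prob_space_PiM) (rule D)
  then have P: "prob_space (density (sample p n) (\<lambda>X. ennreal (lik p n \<kappa> v X)))" unfolding * .
  have "emeasure (density (sample p n) (\<lambda>X. ennreal (lik p n \<kappa> v X))) (space (sample p n)) = 1"
    using prob_space.emeasure_space_1[OF P] by simp
  then show "(\<integral>\<^sup>+X. ennreal (lik p n \<kappa> v X) \<partial>sample p n) = 1"
    by (subst (asm) emeasure_density) (auto cong: nn_integral_cong)
qed

subsection \<open>Truncated likelihood ratios\<close>

lemma sample_exp_cmult:
  assumes p: "0 < p" and q: "q \<in> borel_measurable (Rn p)"
  shows "(\<integral>\<^sup>+X. K * ennreal (exp (\<Sum>j<n. q (X j))) \<partial>sample p n) = K * (\<integral>\<^sup>+y. ennreal (exp (q y)) \<partial>unif_sphere p) ^ n"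
proof -
  have "(\<lambda>X. q (X j)) \<in> borel_measurable (sample p n)" if "j \<in> {..<n}" for j
    using that by (intro measurable_sample_compose q) auto
  then have [measurable]: "(\<lambda>X. \<Sum>j<n. q (X j)) \<in> borel_measurable (sample p n)"
    by (intro borel_measurable_sum)
  have "(\<integral>\<^sup>+X. K * ennreal (exp (\<Sum>j<n. q (X j))) \<partial>sample p n) = K * (\<integral>\<^sup>+X. ennreal (exp (\<Sum>j<n. q (X j))) \<partial>sample p n)"
    by (rule nn_integral_cmult) measurable
  then show ?thesis using sample_exp[OF p q] by simp
qed

text \<open>With \<open>s = t / (1 + t)\<close> the Gaussian normaliser is
  \<open>1 / sqrt (1 - s) = sqrt (1 + t)\<close>. The relation \<open>n t^2 = e p\<close> turns the
  \<open>n\<close>-th power of the loss \<open>exp (- 3 t^2 / (2 p))\<close> into a constant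
  independent of \<open>n\<close> and \<open>p\<close>.\<close>

lemma watson_norm_power_ge:
  fixes t e :: real
  assumes p: "0 < p" and v: "v \<in> usphere p" and t: "0 \<le> t"
    and e: "real n * t\<^sup>2 = e * p"
  shows "exp (- (3 * e / 2)) * sqrt (1 + t) ^ n \<le> watson_norm p (t / (1 + t) * p / 2) v ^ n"
proof -
  define s where "s = t / (1 + t)"
  have s: "0 \<le> s" "s < 1" "1 - s = 1 / (1 + t)" "s / (1 - s) = t"
    using t by (auto simp: s_def field_simps)
  have "exp (- 3 * t\<^sup>2 / (2 * p)) * sqrt (1 + t) \<le> watson_norm p (s * p / 2) v"
    using watson_norm_ge[OF p v s(1,2)] unfolding s(4) unfolding s(3) by (simp add: real_sqrt_divide)
  then have "(exp (- 3 * t\<^sup>2 / (2 * p)) * sqrt (1 + t)) ^ n \<le> watson_norm p (s * p / 2) v ^ n"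
    using t by (intro power_mono) auto
  moreover have "exp (- 3 * t\<^sup>2 / (2 * p)) ^ n = exp (- (3 * e / 2))"
  proof -
    have "real n * (- 3 * t\<^sup>2 / (2 * p)) = - 3 / (2 * p) * (real n * t\<^sup>2)"
      by simp
    also have "\<dots> = - (3 * e / 2)" unfolding e using p by simp
    finally show ?thesis by (simp only: exp_of_nat_mult[symmetric])
  qed
  ultimately show ?thesis by (simp add: power_mult_distrib s_def)
qed

text \<open>A Chernoff bound under the alternative: the indicator is dominated by
  \<open>exp (h * (T - R))\<close>, with \<open>T\<close> the statistic. The tilted moment is
  \<open>(2 * (1 + t)) ^ (n / 2)\<close> at most; the normaliser cancels the powers of
  \<open>1 + t\<close>, and \<open>h * R = n\<close> leaves the geometric factor
  \<open>sqrt 2 / exp 1 < 1\<close>.\<close>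

lemma lik_truncation:
  fixes t e :: real
  assumes p: "0 < p" and v: "v \<in> usphere p" and t: "0 \<le> t"
    and e: "real n * t\<^sup>2 = e * p"
  shows "(\<integral>\<^sup>+X. ennreal (lik p n (t / (1 + t) * p / 2) v X * indicator {X. 4 * real n * (1 + t) / p < tstat p n v X} X) \<partial>sample p n)
    \<le> ennreal (exp (3 * e / 2) * (sqrt 2 / exp 1) ^ n)"
proof -
  define s where "s = t / (1 + t)"
  define \<kappa> where "\<kappa> = s * p / 2"
  define W where "W = watson_norm p \<kappa> v"
  define R where "R = 4 * real n * (1 + t) / p"
  \<comment> \<open>Adding this \<open>h\<close> to \<kappa> moves the parameter \<open>s\<close> to
    the midpoint \<open>s'\<close> of \<open>s\<close> and 1, so that \<open>1 - s\<close> is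
    halved.\<close>
  define h where "h = p / (4 * (1 + t))"
  define s' where "s' = s + (1 - s) / 2"
  have s: "0 \<le> s" "s < 1" "1 - s = 1 / (1 + t)"
    using t by (auto simp: s_def field_simps)
  have s': "0 \<le> s'" "s' < 1" "1 - s' = 1 / (2 * (1 + t))"
  proof -
    have eq: "1 - s' = (1 - s) / 2" by (simp add: s'_def field_simps)
    have eq2: "s' = (1 + s) / 2" by (simp add: s'_def field_simps)
    show "1 - s' = 1 / (2 * (1 + t))" unfolding eq s(3) by simp
    show "0 \<le> s'" unfolding eq2 using s(1) by simp
    show "s' < 1" unfolding eq2 using s(2) by simp
  qed
  have h: "0 < h" using p t by (simp add: h_def)
  have kh: "\<kappa> + h = s' * p / 2"
  proof -
    have "s' = s + 1 / (1 + t) / 2" unfolding s'_def s(3) ..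
    moreover have "h = p * (1 / (1 + t)) / 4" by (simp add: h_def)
    ultimately show ?thesis unfolding \<kappa>_def by (simp only:) (simp add: distrib_right add_divide_distrib)
  qed
  have hR: "h * R = n" 
  proof -
    have "1 + t \<noteq> 0" using t by simp
    then show ?thesis using p by (simp add: h_def R_def del: distrib_left_numeral)
  qed
  have W1: "1 \<le> W" unfolding W_def using watson_norm(2)[OF p v, of \<kappa>] s by (simp add: \<kappa>_def)
  have Wn: "exp (- (3 * e / 2)) * sqrt (1 + t) ^ n \<le> W ^ n"
    using watson_norm_power_ge[OF p v t e] by (simp add: W_def \<kappa>_def s_def)
  have "(\<integral>\<^sup>+X. ennreal (lik p n \<kappa> v X * indicator {X. R < tstat p n v X} X) \<partial>sample p n)
    \<le> (\<integral>\<^sup>+X. ennreal (exp (- n) / W ^ n) * ennreal (exp (\<Sum>j<n. s' * p / 2 * (dot p v (X j))\<^sup>2)) \<partial>sample p n)"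
  proof (rule nn_integral_mono)
    fix X
    have T: "(\<Sum>j<n. s' * p / 2 * (dot p v (X j))\<^sup>2) = (\<kappa> + h) * tstat p n v X"
      unfolding tstat_def kh by (simp add: sum_distrib_left)
    have "exp (\<kappa> * tstat p n v X) * indicator {X. R < tstat p n v X} X \<le> exp (- n) * exp ((\<kappa> + h) * tstat p n v X)"
    proof (cases "R < tstat p n v X")
      case True
      then have "h * R \<le> h * tstat p n v X" using h by simp
      then have "\<kappa> * tstat p n v X \<le> - n + (\<kappa> + h) * tstat p n v X"
        using hR by (simp add: distrib_right)
      then show ?thesis using True by (simp add: exp_add[symmetric])
    qed simp
    then have "lik p n \<kappa> v X * indicator {X. R < tstat p n v X} X \<le> exp (- n) / W ^ n * exp ((\<kappa> + h) * tstat p n v X)"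
      using W1 unfolding lik_def W_def[symmetric] by (simp add: divide_right_mono)
    then show "ennreal (lik p n \<kappa> v X * indicator {X. R < tstat p n v X} X)
       \<le> ennreal (exp (- n) / W ^ n) * ennreal (exp (\<Sum>j<n. s' * p / 2 * (dot p v (X j))\<^sup>2))"
      unfolding T using W1 by (simp add: ennreal_mult[symmetric] ennreal_leI)
  qed
  also have "\<dots> = ennreal (exp (- n) / W ^ n) * (\<integral>\<^sup>+y. ennreal (exp (s' * p / 2 * (dot p v y)\<^sup>2)) \<partial>unif_sphere p) ^ n"
    by (rule sample_exp_cmult[OF p, where q = "\<lambda>y. s' * p / 2 * (dot p v y)\<^sup>2"]) measurable
  also have "\<dots> \<le> ennreal (exp (- n) / W ^ n) * ennreal (1 / sqrt (1 - s')) ^ n"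
    using sphere_mgf_le[OF p v s'(1,2)] by (intro mult_left_mono power_mono) auto
  also have "\<dots> = ennreal (exp (- n) / W ^ n * sqrt (2 * (1 + t)) ^ n)"
    unfolding s'(3) using W1 t by (simp add: ennreal_power ennreal_mult[symmetric] real_sqrt_divide)
  also have "\<dots> \<le> ennreal (exp (3 * e / 2) * (sqrt 2 / exp 1) ^ n)"
  proof (rule ennreal_leI)
    have pos: "0 < exp (- (3 * e / 2)) * sqrt (1 + t) ^ n" using t by simp
    have "exp (- n) / W ^ n * sqrt (2 * (1 + t)) ^ n \<le> exp (- n) / (exp (- (3 * e / 2)) * sqrt (1 + t) ^ n) * sqrt (2 * (1 + t)) ^ n"
      using Wn pos t W1 by (intro mult_right_mono divide_left_mono mult_pos_pos) auto
    also have "\<dots> = exp (3 * e / 2) * (sqrt 2 / exp 1) ^ n"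
    proof -
      have "sqrt (2 * (1 + t)) ^ n = sqrt 2 ^ n * sqrt (1 + t) ^ n"
        by (simp only: real_sqrt_mult power_mult_distrib)
      moreover have "sqrt (1 + t) ^ n \<noteq> 0" using t by simp
      moreover have "exp 1 ^ n = exp (real n)" by (simp add: exp_of_nat_mult[symmetric])
      ultimately show ?thesis by (simp add: power_divide exp_minus field_simps)
    qed
    finally show "exp (- n) / W ^ n * sqrt (2 * (1 + t)) ^ n \<le> exp (3 * e / 2) * (sqrt 2 / exp 1) ^ n" .
  qed
  finally show ?thesis unfolding \<kappa>_def s_def R_def .
qed

text \<open>On this range \<open>(1 - x) * (1 + 2 * x) = 1 + x - 2 * x^2\<close> is at least 1. The
  bound 1/4 is what \<open>u * r \<le> 1 / 2\<close> gives for \<open>x = u^2 * r^2\<close>.\<close>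

lemma inv_sqrt_le_exp:
  fixes x :: real
  assumes "0 \<le> x" "x \<le> 1 / 4"
  shows "1 / sqrt (1 - x) \<le> exp x"
proof -
  have "1 \<le> (1 - x) * (1 + 2 * x)"
    using assms mult_left_mono[of x "1/4" x] by (simp add: algebra_simps)
  also have "\<dots> \<le> (1 - x) * exp (2 * x)"
    using assms by (intro mult_left_mono exp_ge_add_one_self) auto
  finally have "1 \<le> sqrt (1 - x) * sqrt (exp (2 * x))"
    by (simp flip: real_sqrt_mult)
  also have "sqrt (exp (2 * x)) = exp x"
    by (rule real_sqrt_unique) (auto simp: exp_double)
  finally show ?thesis using assms by (simp add: field_simps)
qed

text \<open>
  On the truncation event, \<open>\<kappa>\<close> may be lowered to the value with parameter \<open>u\<close> in place of \<open>t\<close>, at the price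
  of the first summand. This makes the pair moment converge; for small \<open>t r\<close> one takes \<open>u = t\<close>, otherwise
  \<open>u = 1 / (2 r)\<close>.
\<close>

lemma truncation_parameter:
  fixes t r :: real
  assumes t: "0 \<le> t" and r: "0 \<le> r" "r \<le> 1"
  obtains u where "0 \<le> u" "u \<le> t" "u * r \<le> 1 / 2"
    "4 * (1 + t) * (t / (1 + t) - u / (1 + u)) + u\<^sup>2 * r\<^sup>2 \<le> 49 * (t\<^sup>2 * r\<^sup>2)"
proof (cases "t * r \<le> 1 / 2")
  case True
  then show ?thesis using t by (intro that[of t]) auto
next
  case False
  then have r0: "0 < r" using r t by (cases "r = 0") auto
  define u where "u = 1 / (2 * r)"
  have u0: "0 < u" using r0 by (simp add: u_def)
  have ur: "u * r = 1 / 2" using r0 by (simp add: u_def)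
  have ut: "u \<le> t" using False r0 by (simp add: u_def field_simps)
  have t1: "1 / 2 < t" using False r t mult_left_le[of r t] by linarith
  define b where "b = t * r"
  have b: "1 / 2 < b" using False by (simp add: b_def)
  \<comment> \<open>Origin of 49: the difference is at most \<open>2 * r\<close>, and
    \<open>1 + t \<le> 3 * t\<close> since \<open>t > 1 / 2\<close>, so the cost of lowering is at
    most \<open>24 * b\<close>. As \<open>b > 1 / 2\<close>, this is at most
    \<open>48 * b^2\<close>, and \<open>u^2 * r^2\<close> contributes one more
    \<open>b^2\<close>.\<close>
  have "t / (1 + t) - u / (1 + u) = 1 / (1 + u) - 1 / (1 + t)"
    using t u0 by (simp add: field_simps)
  also have "\<dots> \<le> 1 / (1 + u)" using t by simp
  also have "\<dots> \<le> 1 / u" using u0 by (intro divide_left_mono) auto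
  also have "\<dots> = 2 * r" by (simp add: u_def)
  finally have "4 * (1 + t) * (t / (1 + t) - u / (1 + u)) \<le> 4 * (1 + t) * (2 * r)"
    using t by (intro mult_left_mono) auto
  also have "\<dots> \<le> 4 * (3 * t) * (2 * r)"
    using t1 r by (intro mult_right_mono) auto
  also have "\<dots> = 24 * b" by (simp add: b_def)
  also have "\<dots> \<le> 48 * b\<^sup>2"
    using b mult_right_mono[of "1/2" b b] by (simp add: power2_eq_square)
  finally have 1: "4 * (1 + t) * (t / (1 + t) - u / (1 + u)) \<le> 48 * b\<^sup>2" .
  have "u\<^sup>2 * r\<^sup>2 = (1 / 2)\<^sup>2" unfolding power_mult_distrib[symmetric] ur ..
  also have "\<dots> \<le> b\<^sup>2" using b by (intro power_mono) auto
  finally have 2: "u\<^sup>2 * r\<^sup>2 \<le> b\<^sup>2" .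
  show ?thesis
    using u0 ut ur 1 2 by (intro that[of u]) (auto simp: b_def power_mult_distrib)
qed

text \<open>Lowering \<kappa> to \<open>s * p / 2\<close> on the truncation event costs the constant
  in \<open>K\<close>, after which the pair moment per observation is
  \<open>(1 + u) / sqrt (1 - u^2 * r^2)\<close>, at most \<open>(1 + t) * exp (u^2 * r^2)\<close>.
  The factor \<open>(1 + t) ^ n\<close> cancels against the two normalisers, whose losses
  \<open>exp (3 * e / 2)\<close> multiply to \<open>exp (3 * e)\<close>; the rest is what
  \<open>truncation_parameter\<close> bounds.\<close>

lemma lik_second_moment:
  fixes t e :: real
  assumes p: "0 < p" and v: "v \<in> usphere p" and w: "w \<in> usphere p" and t: "0 \<le> t"
    and e: "real n * t\<^sup>2 = e * p"
  defines "\<kappa> \<equiv> t / (1 + t) * p / 2"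
  defines "A \<equiv> \<lambda>v. {X. tstat p n v X \<le> 4 * real n * (1 + t) / p}"
  shows "(\<integral>\<^sup>+X. ennreal (lik p n \<kappa> v X * indicator (A v) X * (lik p n \<kappa> w X * indicator (A w) X)) \<partial>sample p n)
    \<le> ennreal (exp (3 * e) * exp (49 * e * p * (dot p v w)\<^sup>2))"
proof -
  define r where "r = \<bar>dot p v w\<bar>"
  have r: "0 \<le> r" "r \<le> 1"
    using dot_sq_le[OF v w] by (auto simp: r_def abs_square_le_1)
  obtain u where u: "0 \<le> u" "u \<le> t" "u * r \<le> 1 / 2"
    "4 * (1 + t) * (t / (1 + t) - u / (1 + u)) + u\<^sup>2 * r\<^sup>2 \<le> 49 * (t\<^sup>2 * r\<^sup>2)"
    using truncation_parameter[OF t r] by blast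
  define s where "s = u / (1 + u)"
  have s: "0 \<le> s" "s < 1" "1 - s = 1 / (1 + u)"
    using u by (auto simp: s_def field_simps)
  have sk: "s * p / 2 \<le> \<kappa>"
  proof -
    have "s \<le> t / (1 + t)" using t u by (simp add: s_def field_simps)
    then show ?thesis unfolding \<kappa>_def by (intro divide_right_mono mult_right_mono) auto
  qed
  define R where "R = 4 * real n * (1 + t) / p"
  define Wv where "Wv = watson_norm p \<kappa> v"
  define Ww where "Ww = watson_norm p \<kappa> w"
  have k0: "0 \<le> \<kappa>" using t by (simp add: \<kappa>_def)
  have W1: "1 \<le> Wv" "1 \<le> Ww" unfolding Wv_def Ww_def using watson_norm(2)[OF p] v w k0 by auto
  define D where "D = exp (- (3 * e / 2)) * sqrt (1 + t) ^ n"
  have D0: "0 < D" using t by (simp add: D_def)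
  have DW: "D \<le> Wv ^ n" "D \<le> Ww ^ n"
    unfolding D_def Wv_def Ww_def \<kappa>_def using watson_norm_power_ge[OF p _ t e] v w by auto
  define K where "K = exp ((\<kappa> - s * p / 2) * (2 * R)) / (D * D)"
  have K0: "0 \<le> K" using D0 by (simp add: K_def)
  have "(\<integral>\<^sup>+X. ennreal (lik p n \<kappa> v X * indicator (A v) X * (lik p n \<kappa> w X * indicator (A w) X)) \<partial>sample p n)
    \<le> (\<integral>\<^sup>+X. ennreal K * ennreal (exp (\<Sum>j<n. s * p / 2 * ((dot p v (X j))\<^sup>2 + (dot p w (X j))\<^sup>2))) \<partial>sample p n)"
  proof (rule nn_integral_mono)
    fix X
    define T where "T = tstat p n v X + tstat p n w X"
    have Teq: "(\<Sum>j<n. s * p / 2 * ((dot p v (X j))\<^sup>2 + (dot p w (X j))\<^sup>2)) = s * p / 2 * T"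
      by (simp only: T_def tstat_def sum.distrib[symmetric] sum_distrib_left)
    have "lik p n \<kappa> v X * indicator (A v) X * (lik p n \<kappa> w X * indicator (A w) X) \<le> K * exp (s * p / 2 * T)"
    proof (cases "X \<in> A v \<and> X \<in> A w")
      case True
      then have "tstat p n v X \<le> R" "tstat p n w X \<le> R" by (simp_all add: A_def R_def)
      then have "T \<le> 2 * R" by (simp add: T_def)
      \<comment> \<open>Only the excess of \<kappa> over the lowered value is bounded by means of
        the truncation; the part \<open>s * p / 2\<close> of the exponent stays random and is
        integrated exactly over the sample.\<close>
      then have "(\<kappa> - s * p / 2) * T \<le> (\<kappa> - s * p / 2) * (2 * R)"
        using sk by (intro mult_left_mono) auto
      then have "\<kappa> * T \<le> (\<kappa> - s * p / 2) * (2 * R) + s * p / 2 * T"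
        by (simp add: left_diff_distrib)
      then have ex: "exp (\<kappa> * T) \<le> exp ((\<kappa> - s * p / 2) * (2 * R)) * exp (s * p / 2 * T)"
        by (simp add: exp_add[symmetric])
      have "lik p n \<kappa> v X * lik p n \<kappa> w X = exp (\<kappa> * T) / (Wv ^ n * Ww ^ n)"
        by (simp add: lik_def Wv_def Ww_def T_def distrib_left exp_add)
      also have "\<dots> \<le> exp (\<kappa> * T) / (D * D)"
        using DW D0 by (intro divide_left_mono mult_mono mult_pos_pos) (auto intro: less_le_trans)
      also have "\<dots> \<le> exp ((\<kappa> - s * p / 2) * (2 * R)) * exp (s * p / 2 * T) / (D * D)"
        using ex D0 by (intro divide_right_mono) auto
      finally show ?thesis using True by (simp add: K_def)
    qed (use K0 in auto)
    then show "ennreal (lik p n \<kappa> v X * indicator (A v) X * (lik p n \<kappa> w X * indicator (A w) X))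
      \<le> ennreal K * ennreal (exp (\<Sum>j<n. s * p / 2 * ((dot p v (X j))\<^sup>2 + (dot p w (X j))\<^sup>2)))"
      unfolding Teq using K0 by (simp add: ennreal_mult[symmetric] ennreal_leI)
  qed
  also have "\<dots> = ennreal K * (\<integral>\<^sup>+y. ennreal (exp (s * p / 2 * ((dot p v y)\<^sup>2 + (dot p w y)\<^sup>2))) \<partial>unif_sphere p) ^ n"
    by (rule sample_exp_cmult[OF p, where q = "\<lambda>y. s * p / 2 * ((dot p v y)\<^sup>2 + (dot p w y)\<^sup>2)"]) measurable
  also have "\<dots> \<le> ennreal K * ennreal (1 / sqrt ((1 - s)\<^sup>2 - s\<^sup>2 * (dot p v w)\<^sup>2)) ^ n"
  proof -
    have "s * \<bar>dot p v w\<bar> = u * r / (1 + u)" by (simp add: s_def r_def)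
    also have "\<dots> < 1 - s" unfolding s(3) using u by (intro divide_strict_right_mono) auto
    finally show ?thesis
      using sphere_mgf_pair_le[OF p v w s(1,2)] by (intro mult_left_mono power_mono) auto
  qed
  also have "\<dots> \<le> ennreal K * ennreal ((1 + t) * exp (u\<^sup>2 * r\<^sup>2)) ^ n"
  proof -
    have x: "0 \<le> u\<^sup>2 * r\<^sup>2" "u\<^sup>2 * r\<^sup>2 \<le> 1 / 4"
      using power_mono[OF u(3), of 2] u r by (auto simp: power_mult_distrib[symmetric] power_divide)
    have "(1 - s)\<^sup>2 - s\<^sup>2 * (dot p v w)\<^sup>2 = (1 - u\<^sup>2 * r\<^sup>2) / (1 + u)\<^sup>2"
      unfolding s(3) by (simp add: s_def r_def power_divide diff_divide_distrib)
    then have "1 / sqrt ((1 - s)\<^sup>2 - s\<^sup>2 * (dot p v w)\<^sup>2) = (1 + u) * (1 / sqrt (1 - u\<^sup>2 * r\<^sup>2))"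
      using u by (simp add: real_sqrt_divide)
    also have "\<dots> \<le> (1 + t) * exp (u\<^sup>2 * r\<^sup>2)"
      using u inv_sqrt_le_exp[OF x] x by (intro mult_mono) auto
    finally show ?thesis
      by (intro mult_left_mono power_mono ennreal_leI) auto
  qed
  also have "\<dots> = ennreal (K * ((1 + t) * exp (u\<^sup>2 * r\<^sup>2)) ^ n)"
    using K0 t by (simp add: ennreal_power ennreal_mult[symmetric])
  also have "\<dots> \<le> ennreal (exp (3 * e) * exp (49 * e * p * (dot p v w)\<^sup>2))"
  proof (rule ennreal_leI)
    have "D * D = exp (- (3 * e)) * (1 + t) ^ n"
    proof -
      have "D * D = (exp (- (3 * e / 2)) * exp (- (3 * e / 2))) * (sqrt (1 + t) * sqrt (1 + t)) ^ n"
        unfolding D_def power_mult_distrib by (simp only: ac_simps)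
      then show ?thesis using t by (simp add: exp_add[symmetric])
    qed
    then have DD: "D * D = inverse (exp (3 * e)) * (1 + t) ^ n" by (simp only: exp_minus)
    have gen: "E / (inverse F * P) * (P * Y) = E * F * Y" if "P \<noteq> 0" "F \<noteq> 0" for E F P Y :: real
      using that by (simp add: divide_inverse)
    have "K * ((1 + t) * exp (u\<^sup>2 * r\<^sup>2)) ^ n = exp ((\<kappa> - s * p / 2) * (2 * R)) * exp (3 * e) * exp (u\<^sup>2 * r\<^sup>2) ^ n"
      unfolding K_def DD power_mult_distrib[of "1 + t"] using t by (intro gen) auto
    also have "\<dots> = exp (3 * e) * exp ((\<kappa> - s * p / 2) * (2 * R) + n * (u\<^sup>2 * r\<^sup>2))"
      by (simp add: exp_add exp_of_nat_mult)
    also have "(\<kappa> - s * p / 2) * (2 * R) + n * (u\<^sup>2 * r\<^sup>2) = n * (4 * (1 + t) * (t / (1 + t) - u / (1 + u)) + u\<^sup>2 * r\<^sup>2)"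
    proof -
      have gen: "a * P / 2 - b * P / 2 = P / 2 * (a - b)" for a b P :: real
        by (simp add: field_simps)
      have "\<kappa> - s * p / 2 = p / 2 * (t / (1 + t) - u / (1 + u))"
        unfolding \<kappa>_def s_def by (rule gen)
      moreover have "p / 2 * x * (2 * R) = n * (4 * (1 + t) * x)" for x
        using p by (simp add: R_def)
      ultimately show ?thesis by (simp only: distrib_left)
    qed
    also have "exp (3 * e) * exp \<dots> \<le> exp (3 * e) * exp (n * (49 * (t\<^sup>2 * r\<^sup>2)))"
      using u(4) by (intro mult_left_mono) (auto intro: mult_left_mono)
    also have "n * (49 * (t\<^sup>2 * r\<^sup>2)) = 49 * (n * t\<^sup>2) * r\<^sup>2"
      by simp
    also have "\<dots> = 49 * e * p * (dot p v w)\<^sup>2"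
      unfolding e by (simp add: r_def)
    finally show "K * ((1 + t) * exp (u\<^sup>2 * r\<^sup>2)) ^ n \<le> exp (3 * e) * exp (49 * e * p * (dot p v w)\<^sup>2)" .
  qed
  finally show ?thesis .
qed

subsection \<open>The prior on sign vectors and the testing bound\<close>

text \<open>The sub-Gaussian bound for a random sign. It is Hoeffding's estimate for the logarithmic
  moment generating function of a fair coin at \<open>2 * x\<close>, recentred; negative
  \<open>x\<close> follows by symmetry.\<close>

lemma exp_plus_exp_minus_le:
  fixes x :: real
  shows "exp x + exp (- x) \<le> 2 * exp (x\<^sup>2 / 2)"
proof -
  have *: "exp x + exp (- x) \<le> 2 * exp (x\<^sup>2 / 2)" if x: "0 \<le> x" for x :: real
  proof -
    have "- (2 * x) * (1 / 2) + ln (1 + 1 / 2 * (exp (2 * x) - 1)) \<le> (2 * x)\<^sup>2 / 8"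
      using x by (intro Hoeffdings_lemma_aux) auto
    then have "ln ((1 + exp (2 * x)) / 2) \<le> x + x\<^sup>2 / 2"
      by (simp add: power_mult_distrib add_divide_distrib diff_divide_distrib)
    then have "exp (ln ((1 + exp (2 * x)) / 2)) \<le> exp (x + x\<^sup>2 / 2)"
      by simp
    then have "(1 + exp (2 * x)) / 2 \<le> exp (x + x\<^sup>2 / 2)"
      by (subst (asm) exp_ln) (auto simp: add_pos_pos)
    then have "exp (- x) * ((1 + exp (2 * x)) / 2) \<le> exp (- x) * exp (x + x\<^sup>2 / 2)"
      by (intro mult_left_mono) auto
    then show ?thesis
      by (simp add: distrib_left exp_add[symmetric] algebra_simps)
  qed
  show ?thesis using *[of x] *[of "- x"] by (cases "0 \<le> x") auto
qed

definition cube :: "nat \<Rightarrow> (nat \<Rightarrow> real) set" where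
  "cube p = (\<Pi>\<^sub>E i\<in>{..<p}. {1 / sqrt p, - (1 / sqrt p)})"

lemma finite_cube: "finite (cube p)"
  unfolding cube_def by (intro finite_PiE) auto

lemma card_cube: "0 < p \<Longrightarrow> card (cube p) = 2 ^ p"
  unfolding cube_def by (simp add: card_PiE numeral_2_eq_2)

lemma cube_sq: "v \<in> cube p \<Longrightarrow> i < p \<Longrightarrow> (v i)\<^sup>2 = 1 / p"
proof -
  assume "v \<in> cube p" "i < p"
  then have "v i = 1 / sqrt p \<or> v i = - (1 / sqrt p)" by (auto simp: cube_def)
  then show ?thesis by (auto simp: power_divide)
qed

lemma cube_usphere: "0 < p \<Longrightarrow> v \<in> cube p \<Longrightarrow> v \<in> usphere p"
proof -
  assume p: "0 < p" and v: "v \<in> cube p"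
  have "(nrm p v)\<^sup>2 = 1" unfolding nrm_sq using cube_sq[OF v] p by simp
  then have "nrm p v = 1" using nrm_nonneg[of p v] by (simp add: power2_eq_1_iff)
  moreover have "v \<in> space (Rn p)" using v by (auto simp: cube_def space_Rn PiE_iff)
  ultimately show ?thesis by (simp add: usphere_eq)
qed

text \<open>For a uniform sign vector \<open>w\<close>, the inner product with \<open>v\<close> is
  sub-Gaussian with variance \<open>1 / p\<close>. Writing the exponential of its square as a
  Gaussian mixture of linear exponentials transfers this bound: the average is at most the mean of
  \<open>exp (a * z^2 / 2)\<close> for a standard normal \<open>z\<close>, which does not depend on
  \<open>p\<close>.\<close>

lemma cube_mgf:
  assumes p: "0 < p" and v: "v \<in> cube p" and a: "0 \<le> a" "a < 1"
  shows "(\<Sum>w\<in>cube p. ennreal (exp (a * p * (dot p v w)\<^sup>2 / 2))) \<le> ennreal (2 ^ p / sqrt (1 - a))"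
proof -
  have one: "(\<Sum>w\<in>cube p. exp (c * dot p v w)) \<le> 2 ^ p * exp (c\<^sup>2 / (2 * p))" for c
  proof -
    have "(\<Sum>w\<in>cube p. exp (c * dot p v w)) = (\<Sum>w\<in>cube p. \<Prod>i<p. exp (c * v i * w i))"
      by (simp add: dot_def sum_distrib_left exp_sum mult.assoc)
    also have "\<dots> = (\<Prod>i<p. \<Sum>y\<in>{1 / sqrt p, - (1 / sqrt p)}. exp (c * v i * y))"
      unfolding cube_def by (rule prod_sum_PiE[symmetric]) auto
    also have "\<dots> \<le> (\<Prod>i<p. 2 * exp (c\<^sup>2 / (2 * p\<^sup>2)))"
    proof (rule prod_mono, intro conjI)
      fix i assume "i \<in> {..<p}"
      then have "(v i)\<^sup>2 = 1 / p" using cube_sq[OF v] by simp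
      then have "(c * v i * (1 / sqrt p))\<^sup>2 = c\<^sup>2 / p\<^sup>2"
        unfolding power_mult_distrib by (simp add: power_divide power2_eq_square[of "real p"])
      then show "(\<Sum>y\<in>{1 / sqrt p, - (1 / sqrt p)}. exp (c * v i * y)) \<le> 2 * exp (c\<^sup>2 / (2 * p\<^sup>2))"
        using exp_plus_exp_minus_le[of "c * v i * (1 / sqrt p)"] p by (simp add: mult.commute)
    qed (auto intro: sum_nonneg)
    also have "\<dots> = 2 ^ p * exp (p * (c\<^sup>2 / (2 * p\<^sup>2)))"
      by (simp only: prod_constant power_mult_distrib exp_of_nat_mult card_lessThan)
    also have "p * (c\<^sup>2 / (2 * p\<^sup>2)) = c\<^sup>2 / (2 * p)"
      using p by (simp add: power2_eq_square)
    finally show ?thesis .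
  qed
  have "(\<Sum>w\<in>cube p. ennreal (exp (a * p * (dot p v w)\<^sup>2 / 2)))
    = (\<Sum>w\<in>cube p. \<integral>\<^sup>+z. ennreal (exp (sqrt (a * p) * z * dot p v w)) \<partial>std_normal)"
    using a by (intro sum.cong refl hubbard_stratonovich) auto
  also have "\<dots> = (\<integral>\<^sup>+z. (\<Sum>w\<in>cube p. ennreal (exp (sqrt (a * p) * z * dot p v w))) \<partial>std_normal)"
    by (rule nn_integral_sum[symmetric]) auto
  also have "\<dots> \<le> (\<integral>\<^sup>+z. ennreal (2 ^ p) * ennreal (exp (a * z\<^sup>2 / 2 + 0 * z)) \<partial>std_normal)"
  proof (rule nn_integral_mono)
    fix z
    have "(\<Sum>w\<in>cube p. exp (sqrt (a * p) * z * dot p v w)) \<le> 2 ^ p * exp ((sqrt (a * p) * z)\<^sup>2 / (2 * p))"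
      by (rule one)
    also have "(sqrt (a * p) * z)\<^sup>2 / (2 * p) = a * z\<^sup>2 / 2 + 0 * z"
      using a p by (simp add: power_mult_distrib)
    finally have "ennreal (\<Sum>w\<in>cube p. exp (sqrt (a * p) * z * dot p v w)) \<le> ennreal (2 ^ p * exp (a * z\<^sup>2 / 2 + 0 * z))"
      by (rule ennreal_leI)
    then show "(\<Sum>w\<in>cube p. ennreal (exp (sqrt (a * p) * z * dot p v w))) \<le> ennreal (2 ^ p) * ennreal (exp (a * z\<^sup>2 / 2 + 0 * z))"
      by (subst sum_ennreal) (auto simp: ennreal_mult')
  qed
  also have "\<dots> = ennreal (2 ^ p) * ennreal (1 / sqrt (1 - a))"
    by (subst nn_integral_cmult) (auto simp: nn_integral_std_normal_exp[OF a(2), of 0, simplified])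
  also have "\<dots> = ennreal (2 ^ p / sqrt (1 - a))"
    using a by (subst ennreal_mult[symmetric]) auto
  finally show ?thesis .
qed


text \<open>The concentration is the same for all tests; only the location of the bad alternative
  depends on \<phi>, being picked from the sign vectors by the averaging argument.\<close>

lemma watson_test_error:
  assumes p: "0 < p" and n: "3 \<le> n" and \<phi>: "\<phi> \<in> tests n p"
  obtains \<mu> where "\<mu> \<in> watson_alternatives n p (1 / 200)"
    "1 / 4 \<le> prob_test n (unif_sphere p) \<phi> 1 + prob_test n \<mu> \<phi> 0"
proof -
  define e :: real where "e = 1 / 200"
  \<comment> \<open>The solution of \<open>n t^2 = e p\<close>. Since
    \<open>\<kappa> / (p / 2 - \<kappa>) = t\<close>, this puts the alternative exactly on the
    boundary \<open>delta1 n p \<kappa> = e\<close>.\<close>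
  define t where "t = sqrt (e * p / n)"
  define \<kappa> where "\<kappa> = t / (1 + t) * p / 2"
  define R where "R = 4 * real n * (1 + t) / p"
  define A where "A v = {X \<in> space (sample p n). tstat p n v X \<le> R}" for v
  define B where "B = {X \<in> space (sample p n). \<phi> X = 1}"
  have t: "0 < t" using p n by (simp add: t_def e_def)
  have te: "real n * t\<^sup>2 = e * p" using p n by (simp add: t_def e_def)
  have \<kappa>: "0 < \<kappa>" using t p by (simp add: \<kappa>_def)
  have \<kappa>t: "p / 2 - \<kappa> = p / 2 / (1 + t)" using t by (simp add: \<kappa>_def field_simps)
  have pos: "0 < p / 2 - \<kappa>" unfolding \<kappa>t using t p by simp
  then have \<kappa>p: "\<kappa> < p / 2" by simp
  have "\<kappa> = t * (p / 2 - \<kappa>)" unfolding \<kappa>t by (simp add: \<kappa>_def)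
  then have "\<kappa> / (p / 2 - \<kappa>) = t"
    using pos by (metis less_irrefl nonzero_mult_div_cancel_right)
  then have delta: "delta1 n p \<kappa> = e"
    using te p n by (simp add: delta1_def field_simps)
  have alt: "watson p \<kappa> v \<in> watson_alternatives n p (1 / 200)" if "v \<in> cube p" for v
    unfolding watson_alternatives_def mem_Collect_eq
    by (intro exI[of _ \<kappa>] exI[of _ v] conjI refl \<kappa> \<kappa>p cube_usphere[OF p that])
      (simp add: delta e_def)
  have sets_eq: "sets (\<Pi>\<^sub>M j\<in>{..<n}. sphere_borel p) = sets (sample p n)"
    unfolding sample_def by (rule sets_PiM_cong) auto
  have \<phi>m: "\<phi> \<in> sample p n \<rightarrow>\<^sub>M count_space {0, 1}"
    using \<phi> unfolding tests_def measurable_cong_sets[OF sets_eq refl] .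
  have B: "B \<in> sets (sample p n)"
  proof -
    have "B = \<phi> -` {1} \<inter> space (sample p n)" by (auto simp: B_def)
    then show ?thesis using measurable_sets[OF \<phi>m, of "{1}"] by simp
  qed
  have Bc: "space (sample p n) - B = {X \<in> space (sample p n). \<phi> X = 0}"
    using measurable_space[OF \<phi>m] by (force simp: B_def)
  \<comment> \<open>From \<open>exp 1 \<ge> 5 / 2\<close> and \<open>sqrt 2 \<le> 3 / 2\<close> the
    base is at most 3/5, and 1.1 times the cube of 3/5 is 0.2376; this is where
    \<open>n \<ge> 3\<close> comes from.\<close>
  have num1: "exp (3 * e / 2) * (sqrt 2 / exp 1) ^ n \<le> 1 / 4"
  proof -
    have "exp (3 * e / 2) \<le> 1 + 3 * e / 2 + (3 * e / 2)\<^sup>2"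
      by (rule exp_bound) (auto simp: e_def)
    then have 1: "exp (3 * e / 2) \<le> 11 / 10" by (simp add: e_def power2_eq_square)
    have "(5 / 2 :: real) \<le> exp 1" using exp_lower_Taylor_quadratic[of 1] by simp
    moreover have "sqrt 2 \<le> (3 / 2 :: real)" by (rule real_le_lsqrt) (auto simp: power2_eq_square)
    ultimately have 2: "sqrt 2 / exp 1 \<le> (3 / 2) / (5 / 2 :: real)" by (intro frac_le) auto
    have "(sqrt 2 / exp 1) ^ n \<le> (3 / 5 :: real) ^ n" using 2 by (intro power_mono) auto
    also have "\<dots> \<le> (3 / 5) ^ 3" using n by (intro power_decreasing) auto
    finally have "exp (3 * e / 2) * (sqrt 2 / exp 1) ^ n \<le> 11 / 10 * (3 / 5) ^ 3"
      using 1 by (intro mult_mono) auto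
    then show ?thesis by (simp add: power3_eq_cube)
  qed
  \<comment> \<open>Here \<open>98 * e = 0.49\<close> and the square root of 0.51 exceeds 0.7, so
    the quotient is at most 11/7.\<close>
  have num2: "exp (3 * e) / sqrt (1 - 98 * e) \<le> 2"
  proof -
    have "exp (3 * e) \<le> 1 + 3 * e + (3 * e)\<^sup>2"
      by (rule exp_bound) (auto simp: e_def)
    then have 1: "exp (3 * e) \<le> 11 / 10" by (simp add: e_def power2_eq_square)
    have 2: "7 / 10 \<le> sqrt (1 - 98 * e)" by (rule real_le_rsqrt) (auto simp: e_def power2_eq_square)
    have "exp (3 * e) / sqrt (1 - 98 * e) \<le> (11 / 10) / (7 / 10)"
      using 1 2 by (intro frac_le) auto
    also have "\<dots> \<le> 2" by simp
    finally show ?thesis .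
  qed
  have card: "real (card (cube p)) = 2 ^ p" using card_cube[OF p] by simp
  obtain v where v: "v \<in> cube p" and
    main: "1 / 4 \<le> measure (sample p n) B + measure (density (sample p n) (\<lambda>X. ennreal (lik p n \<kappa> v X))) (space (sample p n) - B)"
  proof (rule mixture_second_moment_bound[where M = "sample p n" and \<Theta> = "cube p" and l = "lik p n \<kappa>" and A = A and B = B])
    show "prob_space (sample p n)" by (rule prob_space_sample[OF p])
    show "finite (cube p)" by (rule finite_cube)
    have "card (cube p) \<noteq> 0" using card_cube[OF p] by simp
    then show "cube p \<noteq> {}" by auto
    show "0 \<le> lik p n \<kappa> v X" if v: "v \<in> cube p" for v X
      using watson_norm(2)[OF p cube_usphere[OF p v], of \<kappa>] \<kappa> by (simp add: lik_def)
    show "(\<integral>\<^sup>+X. ennreal (lik p n \<kappa> v X) \<partial>sample p n) = 1" if "v \<in> cube p" for v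
      using \<kappa> by (intro prod_watson(2)[OF p cube_usphere[OF p that]]) auto
    show "A v \<in> sets (sample p n)" for v unfolding A_def by measurable
    fix v assume v: "v \<in> cube p"
    note vs = cube_usphere[OF p v]
    have "(\<integral>\<^sup>+X. ennreal (lik p n \<kappa> v X * indicator (space (sample p n) - A v) X) \<partial>sample p n)
       = (\<integral>\<^sup>+X. ennreal (lik p n \<kappa> v X * indicator {X. R < tstat p n v X} X) \<partial>sample p n)"
      by (intro nn_integral_cong) (auto simp: A_def indicator_def)
    also have "\<dots> \<le> ennreal (exp (3 * e / 2) * (sqrt 2 / exp 1) ^ n)"
      using lik_truncation[OF p vs _ te] t unfolding \<kappa>_def R_def by simp
    also have "\<dots> \<le> ennreal (1 / 4)" by (rule ennreal_leI[OF num1])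
    finally show "(\<integral>\<^sup>+X. ennreal (lik p n \<kappa> v X * indicator (space (sample p n) - A v) X) \<partial>sample p n) \<le> ennreal (1 / 4)" .
    have "(\<Sum>w\<in>cube p. \<integral>\<^sup>+X. ennreal (lik p n \<kappa> v X * indicator (A v) X * (lik p n \<kappa> w X * indicator (A w) X)) \<partial>sample p n)
      \<le> (\<Sum>w\<in>cube p. ennreal (exp (3 * e)) * ennreal (exp (98 * e * p * (dot p v w)\<^sup>2 / 2)))"
    proof (rule sum_mono)
      fix w assume w: "w \<in> cube p"
      note ws = cube_usphere[OF p w]
      have "(\<integral>\<^sup>+X. ennreal (lik p n \<kappa> v X * indicator (A v) X * (lik p n \<kappa> w X * indicator (A w) X)) \<partial>sample p n)
        = (\<integral>\<^sup>+X. ennreal (lik p n \<kappa> v X * indicator {X. tstat p n v X \<le> R} X * (lik p n \<kappa> w X * indicator {X. tstat p n w X \<le> R} X)) \<partial>sample p n)"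
        by (intro nn_integral_cong) (auto simp: A_def indicator_def)
      also have "\<dots> \<le> ennreal (exp (3 * e) * exp (49 * e * p * (dot p v w)\<^sup>2))"
        unfolding \<kappa>_def R_def using t by (intro lik_second_moment[OF p vs ws _ te]) simp
      \<comment> \<open>Halving 98 brings the exponent into the form of \<open>cube_mgf\<close> with
        \<open>a = 98 * e\<close>.\<close>
      also have "49 * e * p * (dot p v w)\<^sup>2 = 98 * e * p * (dot p v w)\<^sup>2 / 2" by simp
      finally show "(\<integral>\<^sup>+X. ennreal (lik p n \<kappa> v X * indicator (A v) X * (lik p n \<kappa> w X * indicator (A w) X)) \<partial>sample p n)
        \<le> ennreal (exp (3 * e)) * ennreal (exp (98 * e * p * (dot p v w)\<^sup>2 / 2))"
        by (simp only: ennreal_mult[OF exp_ge_zero exp_ge_zero])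
    qed
    also have "\<dots> = ennreal (exp (3 * e)) * (\<Sum>w\<in>cube p. ennreal (exp (98 * e * p * (dot p v w)\<^sup>2 / 2)))"
      by (rule sum_distrib_left[symmetric])
    also have "\<dots> \<le> ennreal (exp (3 * e)) * ennreal (2 ^ p / sqrt (1 - 98 * e))"
      by (intro mult_left_mono cube_mgf[OF p v]) (auto simp: e_def)
    also have "\<dots> = ennreal (2 ^ p * (exp (3 * e) / sqrt (1 - 98 * e)))"
      by (subst ennreal_mult[symmetric]) (auto simp: e_def mult.commute)
    also have "\<dots> \<le> ennreal (2 * real (card (cube p)))"
      unfolding card using mult_left_mono[OF num2, of "2 ^ p"] by (intro ennreal_leI) (simp add: mult.commute)
    finally show "(\<Sum>w\<in>cube p. \<integral>\<^sup>+X. ennreal (lik p n \<kappa> v X * indicator (A v) X * (lik p n \<kappa> w X * indicator (A w) X)) \<partial>sample p n)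
      \<le> ennreal (2 * real (card (cube p)))" .
  qed (use B in auto)
  have "prob_test n (unif_sphere p) \<phi> 1 = measure (sample p n) B"
    by (simp add: prob_test_def B_def sample_def)
  moreover have "prob_test n (watson p \<kappa> v) \<phi> 0
      = measure (density (sample p n) (\<lambda>X. ennreal (lik p n \<kappa> v X))) (space (sample p n) - B)"
    unfolding prob_test_def prod_watson(1)[OF p cube_usphere[OF p v] less_imp_le[OF \<kappa>]] Bc by simp
  ultimately show ?thesis using main alt[OF v] by (intro that) auto
qed

theorem theorem5:
  fixes p :: "nat \<Rightarrow> nat"
  assumes "filterlim p at_top sequentially"
  shows "\<exists>\<epsilon>::real. \<epsilon> > 0 \<and>
    liminf (\<lambda>n. INF \<phi>\<in>tests n (p n).
        ereal (prob_test n (unif_sphere (p n)) \<phi> 1)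
        + (SUP \<mu>\<in>watson_alternatives n (p n) \<epsilon>. ereal (prob_test n \<mu> \<phi> 0)))
      \<ge> ereal (1 / 4)"
proof (intro exI[of _ "1 / 200"] conjI)
  \<comment> \<open>As soon as \<open>p n \<ge> 1\<close> and \<open>n \<ge> 3\<close>, the bound
    1/4 holds at the index \<open>n\<close> itself for every test, so it passes to the infimum and
    then to the lower limit.\<close>
  have "\<forall>\<^sub>F n in sequentially. 1 \<le> p n"
    using assms by (simp add: filterlim_at_top)
  then have "\<forall>\<^sub>F n in sequentially. ereal (1 / 4) \<le> (INF \<phi>\<in>tests n (p n).
        ereal (prob_test n (unif_sphere (p n)) \<phi> 1)
        + (SUP \<mu>\<in>watson_alternatives n (p n) (1 / 200). ereal (prob_test n \<mu> \<phi> 0)))"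
    using eventually_ge_at_top[of 3]
  proof eventually_elim
    case (elim n)
    show ?case
    proof (rule INF_greatest)
      fix \<phi> assume \<phi>: "\<phi> \<in> tests n (p n)"
      obtain \<mu> where \<mu>: "\<mu> \<in> watson_alternatives n (p n) (1 / 200)"
        "1 / 4 \<le> prob_test n (unif_sphere (p n)) \<phi> 1 + prob_test n \<mu> \<phi> 0"
        using watson_test_error[OF _ _ \<phi>] elim by auto
      have "ereal (1 / 4) \<le> ereal (prob_test n (unif_sphere (p n)) \<phi> 1) + ereal (prob_test n \<mu> \<phi> 0)"
        using \<mu>(2) by simp
      also have "\<dots> \<le> ereal (prob_test n (unif_sphere (p n)) \<phi> 1)
        + (SUP \<mu>\<in>watson_alternatives n (p n) (1 / 200). ereal (prob_test n \<mu> \<phi> 0))"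
        by (intro add_left_mono SUP_upper \<mu>(1))
      finally show "ereal (1 / 4) \<le> ereal (prob_test n (unif_sphere (p n)) \<phi> 1)
        + (SUP \<mu>\<in>watson_alternatives n (p n) (1 / 200). ereal (prob_test n \<mu> \<phi> 0))" .
    qed
  qed
  then show "ereal (1 / 4) \<le> liminf (\<lambda>n. INF \<phi>\<in>tests n (p n).
        ereal (prob_test n (unif_sphere (p n)) \<phi> 1)
        + (SUP \<mu>\<in>watson_alternatives n (p n) (1 / 200). ereal (prob_test n \<mu> \<phi> 0)))"
    by (rule Liminf_bounded)
qed simp

end
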